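(* Let $\Phi$ be a commutative ring with identity. For every $n\geq 1$, let $L_{n+2}$ be the Lie algebra over $\Phi$ given by generators $x_1,\dots,x_{n+2}$ and the following defining relations: for every $k\leq n$, every commutator of length $k$ in the generators which consists of fewer than $k$ different symbols from $\{x_1,\dots,x_{n+2}\}$ is zero. Then for every $n\geq 1$ the Lie algebra $L_{n+2}$ contains a free Lie subalgebra.
   Context: A commutator of length $k$ in the generators is a Lie monomial: a word $x_{i_1}x_{i_2}\cdots x_{i_k}$ of length $k$ (letters counted with multiplicity) with an arrangement of Lie brackets. It consists of fewer than $k$ different symbols when $|\{i_1,\dots,i_k\}|<k$, i.e. some generator is repeated. For example, the relations for $k=3$ (when $n\geq 3$) include $[[x_i,x_j],x_i]=0$ for $i\neq j$. $L_{n+2}$ is the quotient of the free Lie algebra over $\Phi$ on $x_1,\dots,x_{n+2}$ by the ideal generated by all these commutators for $k\leq n$. *)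

theory Defs
  imports Main
begin

text \<open>
  The sort \<open>{comm_ring, comm_monoid_mult}\<close> is that of commutative rings with identity, the zero
  ring included; \<open>comm_ring_1\<close> would add the axiom \<open>0 \<noteq> 1\<close>.
  Negation in an algebra is scaling by \<open>- 1\<close>, so subalgebras and ideals need no separate closure
  condition for it.
\<close>

record ('a, 'v) lalg =
  lcarrier :: "'v set"
  lzero :: "'v"
  ladd :: "'v \<Rightarrow> 'v \<Rightarrow> 'v"
  lscale :: "'a \<Rightarrow> 'v \<Rightarrow> 'v"
  lbracket :: "'v \<Rightarrow> 'v \<Rightarrow> 'v"

locale nonassoc_algebra =
  fixes L :: "('a::{comm_ring,comm_monoid_mult}, 'v) lalg"
  assumes zero_closed: "lzero L \<in> lcarrier L"
    and add_closed: "\<lbrakk>x \<in> lcarrier L; y \<in> lcarrier L\<rbrakk> \<Longrightarrow> ladd L x y \<in> lcarrier L"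
    and scale_closed: "x \<in> lcarrier L \<Longrightarrow> lscale L a x \<in> lcarrier L"
    and bracket_closed: "\<lbrakk>x \<in> lcarrier L; y \<in> lcarrier L\<rbrakk> \<Longrightarrow> lbracket L x y \<in> lcarrier L"
    and add_assoc: "\<lbrakk>x \<in> lcarrier L; y \<in> lcarrier L; z \<in> lcarrier L\<rbrakk>
      \<Longrightarrow> ladd L (ladd L x y) z = ladd L x (ladd L y z)"
    and add_comm: "\<lbrakk>x \<in> lcarrier L; y \<in> lcarrier L\<rbrakk> \<Longrightarrow> ladd L x y = ladd L y x"
    and add_zero: "x \<in> lcarrier L \<Longrightarrow> ladd L (lzero L) x = x"
    and add_minus: "x \<in> lcarrier L \<Longrightarrow> ladd L (lscale L (- 1) x) x = lzero L"
    and scale_one: "x \<in> lcarrier L \<Longrightarrow> lscale L 1 x = x"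
    and scale_scale: "x \<in> lcarrier L \<Longrightarrow> lscale L a (lscale L b x) = lscale L (a * b) x"
    and scale_add_left: "x \<in> lcarrier L
      \<Longrightarrow> lscale L (a + b) x = ladd L (lscale L a x) (lscale L b x)"
    and scale_add_right: "\<lbrakk>x \<in> lcarrier L; y \<in> lcarrier L\<rbrakk>
      \<Longrightarrow> lscale L a (ladd L x y) = ladd L (lscale L a x) (lscale L a y)"
    and bracket_add_left: "\<lbrakk>x \<in> lcarrier L; y \<in> lcarrier L; z \<in> lcarrier L\<rbrakk>
      \<Longrightarrow> lbracket L (ladd L x y) z = ladd L (lbracket L x z) (lbracket L y z)"
    and bracket_add_right: "\<lbrakk>x \<in> lcarrier L; y \<in> lcarrier L; z \<in> lcarrier L\<rbrakk>
      \<Longrightarrow> lbracket L x (ladd L y z) = ladd L (lbracket L x y) (lbracket L x z)"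
    and bracket_scale_left: "\<lbrakk>x \<in> lcarrier L; y \<in> lcarrier L\<rbrakk>
      \<Longrightarrow> lbracket L (lscale L a x) y = lscale L a (lbracket L x y)"
    and bracket_scale_right: "\<lbrakk>x \<in> lcarrier L; y \<in> lcarrier L\<rbrakk>
      \<Longrightarrow> lbracket L x (lscale L a y) = lscale L a (lbracket L x y)"

definition jacobian :: "('a, 'v) lalg \<Rightarrow> 'v \<Rightarrow> 'v \<Rightarrow> 'v \<Rightarrow> 'v" where
  "jacobian L x y z =
     ladd L (lbracket L (lbracket L x y) z)
       (ladd L (lbracket L (lbracket L y z) x) (lbracket L (lbracket L z x) y))"

locale lie_algebra = nonassoc_algebra L
  for L :: "('a::{comm_ring,comm_monoid_mult}, 'v) lalg" +
  assumes bracket_self: "x \<in> lcarrier L \<Longrightarrow> lbracket L x x = lzero L"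
    and jacobi: "\<lbrakk>x \<in> lcarrier L; y \<in> lcarrier L; z \<in> lcarrier L\<rbrakk>
      \<Longrightarrow> jacobian L x y z = lzero L"

definition lsubalgebra :: "'v set \<Rightarrow> ('a, 'v) lalg \<Rightarrow> bool" where
  "lsubalgebra S L \<longleftrightarrow>
     S \<subseteq> lcarrier L \<and> lzero L \<in> S \<and>
     (\<forall>x\<in>S. \<forall>y\<in>S. ladd L x y \<in> S) \<and>
     (\<forall>a. \<forall>x\<in>S. lscale L a x \<in> S) \<and>
     (\<forall>x\<in>S. \<forall>y\<in>S. lbracket L x y \<in> S)"

definition lideal :: "'v set \<Rightarrow> ('a, 'v) lalg \<Rightarrow> bool" where
  "lideal I L \<longleftrightarrow>
     I \<subseteq> lcarrier L \<and> lzero L \<in> I \<and>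
     (\<forall>x\<in>I. \<forall>y\<in>I. ladd L x y \<in> I) \<and>
     (\<forall>a. \<forall>x\<in>I. lscale L a x \<in> I) \<and>
     (\<forall>x\<in>I. \<forall>y\<in>lcarrier L. lbracket L x y \<in> I \<and> lbracket L y x \<in> I)"

definition generated_lideal :: "('a, 'v) lalg \<Rightarrow> 'v set \<Rightarrow> 'v set" where
  "generated_lideal L R = \<Inter>{I. lideal I L \<and> R \<subseteq> I}"

definition lcoset :: "('a, 'v) lalg \<Rightarrow> 'v set \<Rightarrow> 'v \<Rightarrow> 'v set" where
  "lcoset L I x = ladd L x ` I"

definition lquotient :: "('a, 'v) lalg \<Rightarrow> 'v set \<Rightarrow> ('a, 'v set) lalg" where
  "lquotient L I =
     \<lparr>lcarrier = lcoset L I ` lcarrier L,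
      lzero = lcoset L I (lzero L),
      ladd = (\<lambda>A B. \<Union>x\<in>A. \<Union>y\<in>B. lcoset L I (ladd L x y)),
      lscale = (\<lambda>a A. \<Union>x\<in>A. lcoset L I (lscale L a x)),
      lbracket = (\<lambda>A B. \<Union>x\<in>A. \<Union>y\<in>B. lcoset L I (lbracket L x y))\<rparr>"

definition lhom :: "('a, 'v) lalg \<Rightarrow> ('a, 'w) lalg \<Rightarrow> ('v \<Rightarrow> 'w) \<Rightarrow> bool" where
  "lhom L M \<phi> \<longleftrightarrow>
     \<phi> ` lcarrier L \<subseteq> lcarrier M \<and>
     (\<forall>x\<in>lcarrier L. \<forall>y\<in>lcarrier L. \<phi> (ladd L x y) = ladd M (\<phi> x) (\<phi> y)) \<and>
     (\<forall>a. \<forall>x\<in>lcarrier L. \<phi> (lscale L a x) = lscale M a (\<phi> x)) \<and>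
     (\<forall>x\<in>lcarrier L. \<forall>y\<in>lcarrier L. \<phi> (lbracket L x y) = lbracket M (\<phi> x) (\<phi> y))"

definition lisomorphic :: "('a, 'v) lalg \<Rightarrow> ('a, 'w) lalg \<Rightarrow> bool" where
  "lisomorphic L M \<longleftrightarrow> (\<exists>\<phi>. lhom L M \<phi> \<and> bij_betw \<phi> (lcarrier L) (lcarrier M))"

text \<open>Words with an arrangement of brackets, that is, the elements of the free magma.\<close>

datatype (letters: 'x) bword = Letter 'x | Bracket "'x bword" "'x bword"

fun bword_length :: "'x bword \<Rightarrow> nat" where
  "bword_length (Letter x) = 1"
| "bword_length (Bracket u v) = bword_length u + bword_length v"

fun commutator :: "('a, 'v) lalg \<Rightarrow> ('x \<Rightarrow> 'v) \<Rightarrow> 'x bword \<Rightarrow> 'v" where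
  "commutator L g (Letter x) = g x"
| "commutator L g (Bracket u v) = lbracket L (commutator L g u) (commutator L g v)"

text \<open>
  The free nonassociative algebra on \<open>X\<close> is the magma algebra of the free magma: \<open>f\<close> stands for
  the linear combination of the bracketed words \<open>w\<close> with coefficients \<open>f w\<close>. Each word is a
  product of two words in at most one way, so the convolution sum has at most one term.
\<close>

definition free_nonassoc ::
    "'x set \<Rightarrow> ('a::{comm_ring,comm_monoid_mult}, 'x bword \<Rightarrow> 'a) lalg" where
  "free_nonassoc X =
     \<lparr>lcarrier = {f. finite {w. f w \<noteq> 0} \<and> (\<forall>w. f w \<noteq> 0 \<longrightarrow> letters w \<subseteq> X)},
      lzero = (\<lambda>w. 0),
      ladd = (\<lambda>f g w. f w + g w),
      lscale = (\<lambda>a f w. a * f w),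
      lbracket = (\<lambda>f g w. case w of Letter x \<Rightarrow> 0 | Bracket u v \<Rightarrow> f u * g v)\<rparr>"

definition lie_relators ::
    "'x set \<Rightarrow> ('x bword \<Rightarrow> 'a::{comm_ring,comm_monoid_mult}) set" where
  "lie_relators X =
     (let A = free_nonassoc X in
       {lbracket A f f | f. f \<in> lcarrier A} \<union>
       {jacobian A f g h | f g h. f \<in> lcarrier A \<and> g \<in> lcarrier A \<and> h \<in> lcarrier A})"

definition free_lie ::
    "'x set \<Rightarrow> ('a::{comm_ring,comm_monoid_mult}, ('x bword \<Rightarrow> 'a) set) lalg" where
  "free_lie X =
     lquotient (free_nonassoc X) (generated_lideal (free_nonassoc X) (lie_relators X))"

definition free_lie_gen ::
    "'x set \<Rightarrow> 'x \<Rightarrow> ('x bword \<Rightarrow> 'a::{comm_ring,comm_monoid_mult}) set" where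
  "free_lie_gen X x =
     lcoset (free_nonassoc X) (generated_lideal (free_nonassoc X) (lie_relators X))
       (\<lambda>w. if w = Letter x then 1 else 0)"

definition repeated_commutators ::
    "nat \<Rightarrow> nat \<Rightarrow> (nat bword \<Rightarrow> 'a::{comm_ring,comm_monoid_mult}) set set" where
  "repeated_commutators m n =
     {commutator (free_lie {1..m}) (free_lie_gen {1..m}) w | w.
        letters w \<subseteq> {1..m} \<and> bword_length w \<le> n \<and> card (letters w) < bword_length w}"

text \<open>\<open>rep_free_lie n\<close> is the algebra \<open>L\<^bsub>n+2\<^esub>\<close>.\<close>

definition rep_free_lie ::
    "nat \<Rightarrow> ('a::{comm_ring,comm_monoid_mult}, (nat bword \<Rightarrow> 'a) set set) lalg" where
  "rep_free_lie n =
     lquotient (free_lie {1..n + 2})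
       (generated_lideal (free_lie {1..n + 2}) (repeated_commutators (n + 2) n))"


context nonassoc_algebra
begin

lemma lideal_carrier: "lideal (lcarrier L) L"
  by (simp add: lideal_def zero_closed add_closed scale_closed bracket_closed)

lemma lideal_generated:
  assumes "R \<subseteq> lcarrier L"
  shows "lideal (generated_lideal L R) L"
proof -
  have "generated_lideal L R \<subseteq> lcarrier L"
    using assms lideal_carrier by (auto simp: generated_lideal_def)
  then show ?thesis
    by (simp add: lideal_def[of "generated_lideal L R"]) (simp add: generated_lideal_def lideal_def)
qed

lemma add_left_comm:
  "\<lbrakk>x \<in> lcarrier L; y \<in> lcarrier L; z \<in> lcarrier L\<rbrakk>
    \<Longrightarrow> ladd L x (ladd L y z) = ladd L y (ladd L x z)"
  by (metis add_assoc add_comm)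

lemma add_zero_right: "x \<in> lcarrier L \<Longrightarrow> ladd L x (lzero L) = x"
  using add_comm[OF _ zero_closed] by (simp add: add_zero)

lemma add_minus_right: "x \<in> lcarrier L \<Longrightarrow> ladd L x (lscale L (- 1) x) = lzero L"
  using add_comm[of x "lscale L (- 1) x"] by (simp add: scale_closed add_minus)

lemma add_minus_cancel:
  assumes "x \<in> lcarrier L" "i \<in> lcarrier L"
  shows "ladd L (ladd L x i) (lscale L (- 1) i) = x"
  using assms by (metis add_assoc add_comm add_minus add_zero scale_closed zero_closed)

lemma lcoset_add:
  assumes I: "lideal I L" and x: "x \<in> lcarrier L" and i: "i \<in> I"
  shows "lcoset L I (ladd L x i) = lcoset L I x"
proof -
  have ic: "j \<in> lcarrier L" if "j \<in> I" for j
    using I that by (auto simp: lideal_def)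
  have shift: "lcoset L I (ladd L y j) \<subseteq> lcoset L I y" if "y \<in> lcarrier L" "j \<in> I" for y j
    using I that ic unfolding lcoset_def lideal_def by (auto simp: add_assoc image_iff)
  have "lscale L (- 1) i \<in> I"
    using I i by (simp add: lideal_def)
  from shift[OF add_closed[OF x ic[OF i]] this] shift[OF x i] show ?thesis
    using x i ic by (simp add: add_minus_cancel)
qed

lemma lquotient_ops:
  assumes I: "lideal I L" and x: "x \<in> lcarrier L" and y: "y \<in> lcarrier L"
  shows "ladd (lquotient L I) (lcoset L I x) (lcoset L I y) = lcoset L I (ladd L x y)"
    and "lscale (lquotient L I) a (lcoset L I x) = lcoset L I (lscale L a x)"
    and "lbracket (lquotient L I) (lcoset L I x) (lcoset L I y) = lcoset L I (lbracket L x y)"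
proof -
  have ne: "I \<noteq> {}" and ic: "\<And>j. j \<in> I \<Longrightarrow> j \<in> lcarrier L"
    and cl: "\<And>j k. j \<in> I \<Longrightarrow> k \<in> I \<Longrightarrow> ladd L j k \<in> I" "\<And>a j. j \<in> I \<Longrightarrow> lscale L a j \<in> I"
      "\<And>j z. j \<in> I \<Longrightarrow> z \<in> lcarrier L \<Longrightarrow> lbracket L j z \<in> I"
      "\<And>j z. j \<in> I \<Longrightarrow> z \<in> lcarrier L \<Longrightarrow> lbracket L z j \<in> I"
    using I by (auto simp: lideal_def)
  note closed = add_closed scale_closed bracket_closed
  have "lcoset L I (ladd L (ladd L x i) (ladd L y j)) = lcoset L I (ladd L x y)"
    if "i \<in> I" "j \<in> I" for i j
  proof -
    have "ladd L (ladd L x i) (ladd L y j) = ladd L (ladd L x y) (ladd L i j)"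
      using that x y ic by (simp add: closed add_assoc add_left_comm)
    then show ?thesis
      using that x y cl by (simp add: lcoset_add[OF I] closed)
  qed
  then show "ladd (lquotient L I) (lcoset L I x) (lcoset L I y) = lcoset L I (ladd L x y)"
    using ne by (simp add: lquotient_def lcoset_def[of L I x] lcoset_def[of L I y])
  have "lcoset L I (lscale L a (ladd L x i)) = lcoset L I (lscale L a x)" if "i \<in> I" for i
    using that x ic cl by (simp add: scale_add_right lcoset_add[OF I] closed)
  then show "lscale (lquotient L I) a (lcoset L I x) = lcoset L I (lscale L a x)"
    using ne by (simp add: lquotient_def lcoset_def[of L I x])
  have "lcoset L I (lbracket L (ladd L x i) (ladd L y j)) = lcoset L I (lbracket L x y)"
    if "i \<in> I" "j \<in> I" for i j
    using that x y ic cl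
    by (simp add: bracket_add_left bracket_add_right closed lcoset_add[OF I])
  then show "lbracket (lquotient L I) (lcoset L I x) (lcoset L I y) = lcoset L I (lbracket L x y)"
    using ne by (simp add: lquotient_def lcoset_def[of L I x] lcoset_def[of L I y])
qed

lemma lquotient_carrier_zero:
  "lcarrier (lquotient L I) = lcoset L I ` lcarrier L"
  "lzero (lquotient L I) = lcoset L I (lzero L)"
  by (simp_all add: lquotient_def)

lemma lcoset_eq_zero: "lideal I L \<Longrightarrow> i \<in> I \<Longrightarrow> lcoset L I i = lcoset L I (lzero L)"
  using lcoset_add[of I "lzero L" i] by (auto simp: lideal_def zero_closed add_zero subset_iff)

lemma nonassoc_algebra_lquotient:
  assumes I: "lideal I L"
  shows "nonassoc_algebra (lquotient L I)"
  by standard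
    (auto simp: lquotient_carrier_zero lquotient_ops[OF I] zero_closed add_closed scale_closed
      bracket_closed add_assoc add_zero add_minus scale_one scale_scale scale_add_left
      scale_add_right bracket_add_left bracket_add_right bracket_scale_left bracket_scale_right
      add_comm add_left_comm add_zero_right add_minus_right)

lemma jacobian_closed:
  "\<lbrakk>x \<in> lcarrier L; y \<in> lcarrier L; z \<in> lcarrier L\<rbrakk> \<Longrightarrow> jacobian L x y z \<in> lcarrier L"
  by (simp add: jacobian_def add_closed bracket_closed)

lemma jacobian_lquotient:
  assumes I: "lideal I L" and "x \<in> lcarrier L" "y \<in> lcarrier L" "z \<in> lcarrier L"
  shows "jacobian (lquotient L I) (lcoset L I x) (lcoset L I y) (lcoset L I z) =
    lcoset L I (jacobian L x y z)"
  using assms by (simp add: jacobian_def lquotient_ops[OF I] add_closed bracket_closed)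

lemma lie_algebra_lquotient:
  assumes I: "lideal I L"
    and "\<And>x. x \<in> lcarrier L \<Longrightarrow> lbracket L x x \<in> I"
    and "\<And>x y z. \<lbrakk>x \<in> lcarrier L; y \<in> lcarrier L; z \<in> lcarrier L\<rbrakk> \<Longrightarrow> jacobian L x y z \<in> I"
  shows "lie_algebra (lquotient L I)"
proof -
  interpret Q: nonassoc_algebra "lquotient L I"
    by (rule nonassoc_algebra_lquotient[OF I])
  show ?thesis
    by standard
      (clarsimp simp: lquotient_carrier_zero lquotient_ops[OF I] jacobian_lquotient[OF I],
        intro lcoset_eq_zero[OF I] assms; assumption)+
qed

end

lemma nonassoc_algebra_free_nonassoc:
  "nonassoc_algebra
    (free_nonassoc X :: ('a::{comm_ring,comm_monoid_mult}, 'x bword \<Rightarrow> 'a) lalg)"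
proof
  fix f g :: "'x bword \<Rightarrow> 'a" and a :: 'a
  assume f: "f \<in> lcarrier (free_nonassoc X)"
  have "a * f w \<noteq> 0 \<Longrightarrow> f w \<noteq> 0" for w
    by auto
  with f show "lscale (free_nonassoc X) a f \<in> lcarrier (free_nonassoc X)"
    using finite_subset[of "{w. a * f w \<noteq> 0}" "{w. f w \<noteq> 0}"]
    by (auto simp: free_nonassoc_def)
  assume g: "g \<in> lcarrier (free_nonassoc X)"
  have fin: "finite {w. f w \<noteq> 0}" "finite {w. g w \<noteq> 0}"
    and supp_fg: "\<And>w. f w \<noteq> 0 \<Longrightarrow> letters w \<subseteq> X" "\<And>w. g w \<noteq> 0 \<Longrightarrow> letters w \<subseteq> X"
    using f g by (auto simp: free_nonassoc_def)
  have "finite {w. f w + g w \<noteq> 0}"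
    by (rule finite_subset[OF _ finite_UnI[OF fin]]) auto
  moreover have "letters w \<subseteq> X" if "f w + g w \<noteq> 0" for w
    using supp_fg that by (cases "f w = 0") auto
  ultimately show "ladd (free_nonassoc X) f g \<in> lcarrier (free_nonassoc X)"
    by (simp add: free_nonassoc_def)
  let ?h = "\<lambda>w. case w of Letter x \<Rightarrow> 0 | Bracket u v \<Rightarrow> f u * g v"
  have supp: "\<exists>u v. w = Bracket u v \<and> f u \<noteq> 0 \<and> g v \<noteq> 0" if "?h w \<noteq> 0" for w
    using that by (cases w) auto
  have "{w. ?h w \<noteq> 0} \<subseteq> case_prod Bracket ` ({w. f w \<noteq> 0} \<times> {w. g w \<noteq> 0})"
    using supp by fast
  then have "finite {w. ?h w \<noteq> 0}"
    by (rule finite_subset) (simp add: fin)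
  moreover have "letters w \<subseteq> X" if "?h w \<noteq> 0" for w
    using supp[OF that] supp_fg by (metis Un_least bword.set(2))
  ultimately show "lbracket (free_nonassoc X) f g \<in> lcarrier (free_nonassoc X)"
    by (simp add: free_nonassoc_def)
qed (simp_all add: free_nonassoc_def algebra_simps fun_eq_iff split: bword.split)

lemma lie_relators_cases:
  assumes "r \<in> lie_relators X"
  obtains f where "f \<in> lcarrier (free_nonassoc X)" "r = lbracket (free_nonassoc X) f f"
  | f g h where "f \<in> lcarrier (free_nonassoc X)" "g \<in> lcarrier (free_nonassoc X)"
      "h \<in> lcarrier (free_nonassoc X)" "r = jacobian (free_nonassoc X) f g h"
  using assms unfolding lie_relators_def Let_def by (elim UnE CollectE exE conjE)

lemma lideal_free_lie:
  "lideal (generated_lideal (free_nonassoc X) (lie_relators X))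
    (free_nonassoc X :: ('a::{comm_ring,comm_monoid_mult}, 'x bword \<Rightarrow> 'a) lalg)"
proof -
  interpret nonassoc_algebra "free_nonassoc X :: ('a, 'x bword \<Rightarrow> 'a) lalg"
    by (rule nonassoc_algebra_free_nonassoc)
  show ?thesis
  proof (rule lideal_generated, rule subsetI)
    fix r :: "'x bword \<Rightarrow> 'a"
    assume "r \<in> lie_relators X"
    then show "r \<in> lcarrier (free_nonassoc X)"
      by (cases rule: lie_relators_cases) (simp_all only: bracket_closed jacobian_closed)
  qed
qed

lemma lie_algebra_free_lie:
  "lie_algebra (free_lie X :: ('a::{comm_ring,comm_monoid_mult}, ('x bword \<Rightarrow> 'a) set) lalg)"
proof -
  let ?A = "free_nonassoc X :: ('a, 'x bword \<Rightarrow> 'a) lalg"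
  interpret nonassoc_algebra ?A
    by (rule nonassoc_algebra_free_nonassoc)
  have sub: "r \<in> generated_lideal ?A (lie_relators X)" if "r \<in> lie_relators X" for r
    using that unfolding generated_lideal_def by (intro InterI) (elim CollectE conjE subsetD)
  show ?thesis
    unfolding free_lie_def
  proof (rule lie_algebra_lquotient[OF lideal_free_lie]; rule sub)
    fix f g h
    assume f: "f \<in> lcarrier ?A"
    then show "lbracket ?A f f \<in> lie_relators X"
      unfolding lie_relators_def Let_def by (intro UnI1 CollectI exI[of _ f] conjI refl)
    assume "g \<in> lcarrier ?A" "h \<in> lcarrier ?A"
    with f show "jacobian ?A f g h \<in> lie_relators X"
      unfolding lie_relators_def Let_def
      by (intro UnI2 CollectI exI[of _ f] exI[of _ g] exI[of _ h] conjI refl)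
  qed
qed

lemma free_lie_gen_closed: "x \<in> X \<Longrightarrow> free_lie_gen X x \<in> lcarrier (free_lie X)"
  unfolding free_lie_gen_def free_lie_def lquotient_def lalg.simps
  by (rule imageI) (simp add: free_nonassoc_def)

lemma (in nonassoc_algebra) commutator_closed:
  "(\<And>x. x \<in> letters w \<Longrightarrow> g x \<in> lcarrier L) \<Longrightarrow> commutator L g w \<in> lcarrier L"
  by (induction w) (auto simp: bracket_closed)

lemma lie_algebra_rep_free_lie:
  "lie_algebra (rep_free_lie n :: ('a::{comm_ring,comm_monoid_mult}, _) lalg)"
proof -
  let ?F = "free_lie {1..n + 2} :: ('a, _) lalg"
  interpret lie_algebra ?F
    by (rule lie_algebra_free_lie)
  have "repeated_commutators (n + 2) n \<subseteq> lcarrier ?F"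
    unfolding repeated_commutators_def
    by clarify (rule commutator_closed, rule free_lie_gen_closed, erule (1) subsetD)
  then have I: "lideal (generated_lideal ?F (repeated_commutators (n + 2) n)) ?F"
    by (rule lideal_generated)
  then have "lzero ?F \<in> generated_lideal ?F (repeated_commutators (n + 2) n)"
    unfolding lideal_def by blast
  with I show ?thesis
    unfolding rep_free_lie_def by (intro lie_algebra_lquotient) (simp_all only: bracket_self jacobi)
qed

end

theory Submission
  imports Defs "HOL-Algebra.FiniteProduct" "HOL-Library.List_Lexorder"
begin

text \<open>
  Represent \<open>L\<^bsub>n+2\<^esub>\<close> on functions on words, letting \<open>x\<^sub>i\<close> prepend the letter \<open>i\<close>, but
  only when the resulting word has length congruent to \<open>i\<close> modulo \<open>n\<close>. In a nonzero product of
  at most \<open>n\<close> such operators the indices are consecutive modulo \<open>n\<close>, so no generator occurs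
  twice: all defining relations hold (\<open>staged_repeated_commutator\<close>). On the other hand \<open>x\<^sub>1\<close> and
  \<open>x\<^bsub>n+1\<^esub>\<close> act at the same lengths, which gives two independent ways to go once around the cycle
  of residues, namely the commutators \<open>u = [x\<^sub>n, [x\<^bsub>n-1\<^esub>, \<dots>, [x\<^sub>2, x\<^sub>1]]]\<close> and
  \<open>v = [x\<^sub>n, [x\<^bsub>n-1\<^esub>, \<dots>, [x\<^sub>2, x\<^bsub>n+1\<^esub>]]]\<close>. On words whose length is a multiple of \<open>n\<close>, only
  one of the products in the expansion of \<open>u\<close> survives, and \<open>u\<close> prepends the block
  \<open>n \<dots> 2 1\<close>, while \<open>v\<close> prepends \<open>n \<dots> 2 (n+1)\<close> (\<open>tower_action\<close>). Reading the two blocks as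
  letters, \<open>u\<close> and \<open>v\<close> become left multiplication by two free generators of a free associative
  algebra (\<open>tower_acts_as_letter\<close>).

  It remains to know that the free Lie algebra embeds in the free associative algebra, over an
  arbitrary commutative ring (\<open>free_lie_faithful\<close>). This is proved with the Lyndon basis. The
  bracketed Lyndon words span the free Lie algebra, since the bracket of two of them can be rewritten
  by the Jacobi identity so that the larger of the two words decreases
  (\<open>bracket_lyndon_elements\<close>). They are linearly independent in the associative algebra, since
  the least word in the expansion of a bracketed Lyndon word is the Lyndon word itself, with
  coefficient \<open>1\<close> (\<open>lyndon_leading_word\<close>).

  The homomorphism from the free Lie algebra to \<open>L\<^bsub>n+2\<^esub>\<close> sending the generators to \<open>u\<close> and
  \<open>v\<close> is therefore injective, and its image is the free subalgebra.
\<close>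

section \<open>Homomorphisms, quotients and free objects\<close>

lemma lhomD:
  assumes "lhom L M \<phi>" "x \<in> lcarrier L"
  shows lhom_closed: "\<phi> x \<in> lcarrier M"
    and lhom_add: "y \<in> lcarrier L \<Longrightarrow> \<phi> (ladd L x y) = ladd M (\<phi> x) (\<phi> y)"
    and lhom_scale: "\<phi> (lscale L a x) = lscale M a (\<phi> x)"
    and lhom_bracket: "y \<in> lcarrier L \<Longrightarrow> \<phi> (lbracket L x y) = lbracket M (\<phi> x) (\<phi> y)"
  using assms unfolding lhom_def by auto

context nonassoc_algebra
begin

lemma scale_zero_left:
  assumes "x \<in> lcarrier L"
  shows "lscale L 0 x = lzero L"
proof -
  have "lscale L (- 1 + 1) x = lzero L"
    using assms by (simp only: scale_add_left scale_one add_minus)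
  then show ?thesis by simp
qed

lemma scale_zero_right: "lscale L a (lzero L) = lzero L"
proof -
  have "lscale L a (lscale L 0 (lzero L)) = lscale L 0 (lzero L)"
    by (simp add: scale_scale zero_closed)
  then show ?thesis
    by (simp add: scale_zero_left zero_closed)
qed

lemma bracket_zero_left: "x \<in> lcarrier L \<Longrightarrow> lbracket L (lzero L) x = lzero L"
  using bracket_scale_left[of "lzero L" x 0]
  by (simp add: scale_zero_left zero_closed bracket_closed)

lemma bracket_zero_right: "x \<in> lcarrier L \<Longrightarrow> lbracket L x (lzero L) = lzero L"
  using bracket_scale_right[of x "lzero L" 0]
  by (simp add: scale_zero_left zero_closed bracket_closed)

lemma add_eq_zero_imp:
  assumes "x \<in> lcarrier L" "y \<in> lcarrier L" "ladd L x y = lzero L"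
  shows "y = lscale L (- 1) x"
  using assms by (metis add_assoc add_minus add_zero add_zero_right scale_closed)

lemma add_minus_eq_zero_imp:
  assumes "x \<in> lcarrier L" "y \<in> lcarrier L" "ladd L x (lscale L (- 1) y) = lzero L"
  shows "x = y"
  using assms by (metis add_assoc add_minus add_zero add_zero_right scale_closed)

lemma lhom_zero:
  assumes "lhom L M \<phi>" "nonassoc_algebra M"
  shows "\<phi> (lzero L) = lzero M"
proof -
  interpret M: nonassoc_algebra M by fact
  have "\<phi> (lscale L 0 (lzero L)) = lscale M 0 (\<phi> (lzero L))"
    using assms(1) by (simp only: lhom_scale zero_closed)
  then show ?thesis
    by (simp add: scale_zero_left zero_closed M.scale_zero_left lhom_closed[OF assms(1)])
qed

lemma lhom_commutator:
  assumes "lhom L M \<phi>" "\<And>x. x \<in> letters w \<Longrightarrow> g x \<in> lcarrier L"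
  shows "\<phi> (commutator L g w) = commutator M (\<lambda>x. \<phi> (g x)) w"
  using assms(2)
  by (induction w) (auto simp: lhom_bracket[OF assms(1)] commutator_closed)

lemma lideal_kernel:
  assumes "lhom L M \<phi>" "nonassoc_algebra M"
  shows "lideal {x \<in> lcarrier L. \<phi> x = lzero M} L"
proof -
  interpret M: nonassoc_algebra M by fact
  show ?thesis
    unfolding lideal_def
    by (auto simp: lhomD[OF assms(1)] lhom_zero[OF assms] zero_closed add_closed scale_closed
        bracket_closed M.add_zero M.zero_closed M.scale_zero_right M.bracket_zero_left
        M.bracket_zero_right)
qed

lemma lhom_inj_onI:
  assumes "lhom L M \<phi>" "nonassoc_algebra M"
    and ker: "\<And>x. x \<in> lcarrier L \<Longrightarrow> \<phi> x = lzero M \<Longrightarrow> x = lzero L"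
  shows "inj_on \<phi> (lcarrier L)"
proof (rule inj_onI)
  interpret M: nonassoc_algebra M by fact
  fix x y assume x: "x \<in> lcarrier L" and y: "y \<in> lcarrier L" and eq: "\<phi> x = \<phi> y"
  then have "\<phi> (ladd L x (lscale L (- 1) y)) = lzero M"
    by (simp add: lhomD[OF assms(1)] scale_closed M.add_minus_right)
  with x y have "ladd L x (lscale L (- 1) y) = lzero L"
    by (simp add: ker add_closed scale_closed)
  with x y show "x = y"
    by (rule add_minus_eq_zero_imp)
qed

lemma lisomorphic_image:
  assumes "lhom L M \<phi>" "inj_on \<phi> (lcarrier L)" "nonassoc_algebra M"
  shows "lsubalgebra (\<phi> ` lcarrier L) M"
    and "lisomorphic L (M\<lparr>lcarrier := \<phi> ` lcarrier L\<rparr>)"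
proof -
  have "lzero M \<in> \<phi> ` lcarrier L"
    using lhom_zero[OF assms(1,3)] zero_closed by (metis imageI)
  moreover have "ladd M (\<phi> x) (\<phi> y) \<in> \<phi> ` lcarrier L"
    "lscale M a (\<phi> x) \<in> \<phi> ` lcarrier L" "lbracket M (\<phi> x) (\<phi> y) \<in> \<phi> ` lcarrier L"
    if x: "x \<in> lcarrier L" and y: "y \<in> lcarrier L" for x y a
    using add_closed[OF x y] scale_closed[OF x, of a] bracket_closed[OF x y]
    unfolding lhom_add[OF assms(1) x y, symmetric] lhom_scale[OF assms(1) x, symmetric]
      lhom_bracket[OF assms(1) x y, symmetric] by auto
  ultimately show "lsubalgebra (\<phi> ` lcarrier L) M"
    unfolding lsubalgebra_def using lhom_closed[OF assms(1)] by blast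
  have "lhom L (M\<lparr>lcarrier := \<phi> ` lcarrier L\<rparr>) \<phi>"
    using assms(1) by (simp add: lhom_def)
  with assms(2) show "lisomorphic L (M\<lparr>lcarrier := \<phi> ` lcarrier L\<rparr>)"
    unfolding lisomorphic_def by (intro exI[of _ \<phi>]) (simp add: bij_betw_def)
qed

lemma lhom_lcoset:
  assumes "lideal I L"
  shows "lhom L (lquotient L I) (lcoset L I)"
  using assms by (auto simp: lhom_def lquotient_ops lquotient_carrier_zero)

text \<open>
  The induced map takes the value of \<open>\<phi>\<close> at an arbitrary representative; on a coset all
  representatives have the same value because \<open>\<phi>\<close> vanishes on \<open>I\<close>.
\<close>

lemma lhom_lquotient:
  assumes I: "lideal I L" and hom: "lhom L M \<phi>" and M: "nonassoc_algebra M"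
    and ker: "\<And>x. x \<in> I \<Longrightarrow> \<phi> x = lzero M"
  obtains \<psi> where "lhom (lquotient L I) M \<psi>" "\<forall>x\<in>lcarrier L. \<psi> (lcoset L I x) = \<phi> x"
proof -
  interpret M: nonassoc_algebra M by fact
  define \<psi> where "\<psi> C = \<phi> (SOME x. x \<in> C)" for C
  have eq: "\<psi> (lcoset L I x) = \<phi> x" if x: "x \<in> lcarrier L" for x
  proof -
    have "\<exists>y. y \<in> lcoset L I x"
      using I by (auto simp: lcoset_def lideal_def)
    then have "(SOME y. y \<in> lcoset L I x) \<in> lcoset L I x"
      by (rule someI_ex)
    then obtain i where "i \<in> I" "(SOME y. y \<in> lcoset L I x) = ladd L x i"
      by (auto simp: lcoset_def)
    moreover from this have "i \<in> lcarrier L"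
      using I by (auto simp: lideal_def)
    ultimately show ?thesis
      using x by (simp add: \<psi>_def lhomD[OF hom] ker M.add_zero_right)
  qed
  have "lhom (lquotient L I) M \<psi>"
    unfolding lhom_def
    by (auto simp: lquotient_carrier_zero lquotient_ops[OF I] eq lhomD[OF hom] add_closed
        scale_closed bracket_closed)
  then show thesis
    by (rule that) (simp add: eq)
qed

lemma lhom_lquotient_generated:
  assumes R: "R \<subseteq> lcarrier L" and hom: "lhom L M \<phi>" and M: "nonassoc_algebra M"
    and ker: "\<And>x. x \<in> R \<Longrightarrow> \<phi> x = lzero M"
  obtains \<psi> where "lhom (lquotient L (generated_lideal L R)) M \<psi>"
    "\<forall>x\<in>lcarrier L. \<psi> (lcoset L (generated_lideal L R) x) = \<phi> x"
proof -
  have "generated_lideal L R \<subseteq> {x \<in> lcarrier L. \<phi> x = lzero M}"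
    unfolding generated_lideal_def using R ker lideal_kernel[OF hom M] by blast
  then have "\<phi> x = lzero M" if "x \<in> generated_lideal L R" for x
    using that by auto
  then obtain \<psi> where "lhom (lquotient L (generated_lideal L R)) M \<psi>"
    "\<forall>x\<in>lcarrier L. \<psi> (lcoset L (generated_lideal L R) x) = \<phi> x"
    by (rule lhom_lquotient[OF lideal_generated[OF R] hom M])
  then show thesis
    by (rule that)
qed

end

lemma lhom_jacobian:
  assumes "lhom L M \<phi>" "nonassoc_algebra L" "x \<in> lcarrier L" "y \<in> lcarrier L" "z \<in> lcarrier L"
  shows "\<phi> (jacobian L x y z) = jacobian M (\<phi> x) (\<phi> y) (\<phi> z)"
proof -
  interpret nonassoc_algebra L by fact
  show ?thesis
    using assms(3-) by (simp add: jacobian_def lhomD[OF assms(1)] add_closed bracket_closed)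
qed

definition single_word :: "'x bword \<Rightarrow> 'x bword \<Rightarrow> 'a::{comm_ring,comm_monoid_mult}" where
  "single_word w = (\<lambda>v. if v = w then 1 else 0)"

lemma free_lie_gen_eq:
  "free_lie_gen X x =
    lcoset (free_nonassoc X) (generated_lideal (free_nonassoc X) (lie_relators X))
      (single_word (Letter x))"
  by (simp add: free_lie_gen_def single_word_def)

lemma single_word_closed:
  "letters w \<subseteq> X \<Longrightarrow>
    (single_word w :: 'x bword \<Rightarrow> 'a::{comm_ring,comm_monoid_mult}) \<in> lcarrier (free_nonassoc X)"
  by (auto simp: free_nonassoc_def single_word_def)

lemma bracket_single_word:
  "lbracket (free_nonassoc X) (single_word u) (single_word v) = single_word (Bracket u v)"
  by (auto simp: free_nonassoc_def single_word_def fun_eq_iff split: bword.split)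

lemma free_nonassoc_induct [consumes 1, case_names zero add scale word]:
  fixes f :: "'x bword \<Rightarrow> 'a::{comm_ring,comm_monoid_mult}"
  assumes f: "f \<in> lcarrier (free_nonassoc X)"
    and zero: "P (lzero (free_nonassoc X))"
    and add: "\<And>f g. \<lbrakk>f \<in> lcarrier (free_nonassoc X); g \<in> lcarrier (free_nonassoc X); P f; P g\<rbrakk>
      \<Longrightarrow> P (ladd (free_nonassoc X) f g)"
    and scale: "\<And>a f. \<lbrakk>f \<in> lcarrier (free_nonassoc X); P f\<rbrakk> \<Longrightarrow> P (lscale (free_nonassoc X) a f)"
    and word: "\<And>w. letters w \<subseteq> X \<Longrightarrow> P (single_word w)"
  shows "P f"
proof -
  interpret nonassoc_algebra "free_nonassoc X :: ('a, 'x bword \<Rightarrow> 'a) lalg"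
    by (rule nonassoc_algebra_free_nonassoc)
  have "P f" if "finite W" "f \<in> lcarrier (free_nonassoc X)" "{w. f w \<noteq> 0} \<subseteq> W" for W f
    using that
  proof (induction W arbitrary: f)
    case empty
    then have "f = lzero (free_nonassoc X)"
      by (auto simp: free_nonassoc_def)
    with zero show ?case by simp
  next
    case (insert w W)
    show ?case
    proof (cases "f w = 0")
      case True
      with insert.prems have "{w. f w \<noteq> 0} \<subseteq> W" by auto
      with insert show ?thesis by blast
    next
      case False
      define h where "h = f(w := 0)"
      define s :: "'x bword \<Rightarrow> 'a" where "s = lscale (free_nonassoc X) (f w) (single_word w)"
      from False insert.prems have w: "letters w \<subseteq> X"
        by (auto simp: free_nonassoc_def)
      have supp: "{v. h v \<noteq> 0} \<subseteq> {v. f v \<noteq> 0}" "{v. h v \<noteq> 0} \<subseteq> W"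
        using insert.prems by (auto simp: h_def)
      have h: "h \<in> lcarrier (free_nonassoc X)"
        using insert.prems finite_subset[OF supp(1)] supp(1) by (auto simp: free_nonassoc_def)
      have "f = ladd (free_nonassoc X) s h"
        by (auto simp: h_def s_def free_nonassoc_def single_word_def fun_eq_iff)
      moreover have "P s" and "s \<in> lcarrier (free_nonassoc X)"
        using word[OF w] single_word_closed[OF w, where 'a='a]
        by (auto simp: s_def intro: scale scale_closed)
      ultimately show ?thesis
        using add h insert.IH[OF h supp(2)] by simp
    qed
  qed
  from this[of "{w. f w \<noteq> 0}" f] f show ?thesis
    by (auto simp: free_nonassoc_def)
qed

abbreviation add_monoid_of :: "('a, 'v) lalg \<Rightarrow> 'v monoid" where
  "add_monoid_of L \<equiv> \<lparr>carrier = lcarrier L, mult = ladd L, one = lzero L\<rparr>"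

context nonassoc_algebra
begin

lemma comm_monoid_add: "comm_monoid (add_monoid_of L)"
  by (rule comm_monoidI)
    (simp_all add: zero_closed add_closed add_assoc add_zero add_zero_right, metis add_comm)

text \<open>
  The homomorphism sends a linear combination of words to the corresponding linear combination of
  commutators; the finite sum is a product in the additive monoid of \<open>L\<close>. Once additivity and
  homogeneity are known, compatibility with the bracket needs to be checked only on pairs of words,
  where it holds by the definition of \<open>commutator\<close>.
\<close>

lemma free_nonassoc_universal:
  fixes g :: "'x \<Rightarrow> 'v"
  assumes g: "\<And>x. x \<in> X \<Longrightarrow> g x \<in> lcarrier L"
  obtains \<phi> where "lhom (free_nonassoc X) L \<phi>"
    "\<forall>w. letters w \<subseteq> X \<longrightarrow> \<phi> (single_word w) = commutator L g w"
proof -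
  let ?A = "free_nonassoc X :: ('a, 'x bword \<Rightarrow> 'a) lalg"
  interpret A: nonassoc_algebra ?A
    by (rule nonassoc_algebra_free_nonassoc)
  interpret G: comm_monoid "add_monoid_of L"
    by (rule comm_monoid_add)
  define summand where "summand f w = lscale L (f w) (commutator L g w)" for f w
  define \<phi> where "\<phi> f = finprod (add_monoid_of L) (summand f) {w. f w \<noteq> 0}" for f
  have comm: "commutator L g w \<in> lcarrier L" if "letters w \<subseteq> X" for w
    using that g by (intro commutator_closed) auto
  have summand: "summand f w \<in> lcarrier L" if "letters w \<subseteq> X" for f w
    using that by (simp add: summand_def scale_closed comm)
  have supp: "finite {w. f w \<noteq> 0}" "f w \<noteq> 0 \<Longrightarrow> letters w \<subseteq> X" if "f \<in> lcarrier ?A" for f w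
    using that by (auto simp: free_nonassoc_def)
  have \<phi>_eq: "\<phi> f = finprod (add_monoid_of L) (summand f) W"
    if "finite W" "{w. f w \<noteq> 0} \<subseteq> W" "\<And>w. w \<in> W \<Longrightarrow> letters w \<subseteq> X" for f W
    unfolding \<phi>_def using that
    by (intro G.finprod_mono_neutral_cong_left)
      (auto simp: summand_def scale_zero_left scale_closed comm)
  have closed: "\<phi> f \<in> lcarrier L" if f: "f \<in> lcarrier ?A" for f
  proof -
    have "finprod (add_monoid_of L) (summand f) {w. f w \<noteq> 0} \<in> carrier (add_monoid_of L)"
      by (rule G.finprod_closed) (use supp(2)[OF f] summand in auto)
    then show ?thesis by (simp add: \<phi>_def)
  qed
  have add: "\<phi> (ladd ?A f h) = ladd L (\<phi> f) (\<phi> h)"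
    if f: "f \<in> lcarrier ?A" and h: "h \<in> lcarrier ?A" for f h
  proof -
    let ?W = "{w. f w \<noteq> 0} \<union> {w. h w \<noteq> 0}"
    have W: "finite ?W" "\<And>w. w \<in> ?W \<Longrightarrow> letters w \<subseteq> X"
      using supp f h by blast+
    have "\<phi> (ladd ?A f h) = finprod (add_monoid_of L) (summand (ladd ?A f h)) ?W"
      by (rule \<phi>_eq[OF W(1) _ W(2)]) (auto simp: free_nonassoc_def)
    also have "\<dots> = finprod (add_monoid_of L) (\<lambda>w. summand f w \<otimes>\<^bsub>add_monoid_of L\<^esub> summand h w) ?W"
      by (rule G.finprod_cong)
        (auto simp: simp_implies_def summand_def free_nonassoc_def scale_add_left comm W(2)
          intro!: add_closed scale_closed)
    also have "\<dots> = finprod (add_monoid_of L) (summand f) ?W \<otimes>\<^bsub>add_monoid_of L\<^esub>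
        finprod (add_monoid_of L) (summand h) ?W"
      by (rule G.finprod_multf) (use W(2) summand in auto)
    also have "\<dots> = ladd L (\<phi> f) (\<phi> h)"
      using \<phi>_eq[OF W(1) _ W(2), of f] \<phi>_eq[OF W(1) _ W(2), of h] by simp
    finally show ?thesis .
  qed
  have scale: "\<phi> (lscale ?A a f) = lscale L a (\<phi> f)" if f: "f \<in> lcarrier ?A" for a f
  proof -
    have *: "finprod (add_monoid_of L) (summand (lscale ?A a f)) W =
        lscale L a (finprod (add_monoid_of L) (summand f) W) \<and>
        finprod (add_monoid_of L) (summand f) W \<in> lcarrier L"
      if "finite W" "\<And>w. w \<in> W \<Longrightarrow> letters w \<subseteq> X" for W
      using that
    proof (induction W)
      case empty
      show ?case by (simp add: scale_zero_right zero_closed)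
    next
      case (insert w W)
      then show ?case
        by (subst (1 2 3) G.finprod_insert)
          (auto simp: summand scale_add_right add_closed, simp add: summand_def free_nonassoc_def
            scale_scale comm)
    qed
    have "\<phi> (lscale ?A a f) = finprod (add_monoid_of L) (summand (lscale ?A a f)) {w. f w \<noteq> 0}"
      by (rule \<phi>_eq[OF supp(1)[OF f] _ supp(2)[OF f]]) (auto simp: free_nonassoc_def)
    then show ?thesis
      using *[OF supp(1)[OF f] supp(2)[OF f]] by (simp add: \<phi>_def)
  qed
  have \<phi>_word: "\<phi> (single_word w) = commutator L g w" if "letters w \<subseteq> X" for w
  proof -
    have "\<phi> (single_word w) = finprod (add_monoid_of L) (summand (single_word w)) {w}"
      by (rule \<phi>_eq) (use that in \<open>auto simp: single_word_def\<close>)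
    also have "\<dots> = commutator L g w"
      using that comm[OF that]
      by (subst G.finprod_insert) (auto simp: summand_def single_word_def scale_one add_zero_right)
    finally show ?thesis .
  qed
  have \<phi>_zero: "\<phi> (lzero ?A) = lzero L"
    by (simp add: \<phi>_def free_nonassoc_def)
  have bracket_word: "\<phi> (lbracket ?A (single_word u) h) = lbracket L (\<phi> (single_word u)) (\<phi> h)"
    if u: "letters u \<subseteq> X" and "h \<in> lcarrier ?A" for u h
    using that(2)
  proof (induction rule: free_nonassoc_induct)
    case zero
    show ?case
      using single_word_closed[OF u, where 'a='a]
      by (simp add: A.bracket_zero_right \<phi>_zero bracket_zero_right closed)
  next
    case (word w)
    with u show ?case
      by (simp add: bracket_single_word \<phi>_word)
  qed (use single_word_closed[OF u, where 'a='a] in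
      \<open>simp_all add: A.bracket_add_right A.bracket_scale_right add scale closed
        A.bracket_closed bracket_add_right bracket_scale_right\<close>)
  have "\<phi> (lbracket ?A f h) = lbracket L (\<phi> f) (\<phi> h)"
    if "f \<in> lcarrier ?A" and h: "h \<in> lcarrier ?A" for f h
    using that(1)
  proof (induction rule: free_nonassoc_induct)
    case zero
    show ?case
      using h by (simp add: A.bracket_zero_left \<phi>_zero bracket_zero_left closed)
  next
    case (word w)
    with h show ?case by (rule bracket_word[rotated -1])
  qed (use h in \<open>simp_all add: A.bracket_add_left A.bracket_scale_left add scale closed
        A.bracket_closed bracket_add_left bracket_scale_left\<close>)
  with closed add scale have "lhom ?A L \<phi>"
    by (auto simp: lhom_def)
  then show thesis
    by (rule that) (simp add: \<phi>_word)
qed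

end

lemma (in lie_algebra) free_lie_universal:
  assumes g: "\<And>x. x \<in> X \<Longrightarrow> g x \<in> lcarrier L"
  obtains \<phi> where "lhom (free_lie X) L \<phi>" "\<forall>x\<in>X. \<phi> (free_lie_gen X x) = g x"
proof -
  let ?A = "free_nonassoc X :: ('a, _) lalg"
  interpret A: nonassoc_algebra ?A
    by (rule nonassoc_algebra_free_nonassoc)
  obtain \<phi> where hom: "lhom ?A L \<phi>"
    and word: "\<forall>w. letters w \<subseteq> X \<longrightarrow> \<phi> (single_word w) = commutator L g w"
    by (rule free_nonassoc_universal[OF g])
  have "r \<in> lcarrier ?A \<and> \<phi> r = lzero L" if "r \<in> lie_relators X" for r
    using that
    by (cases rule: lie_relators_cases)
      (auto simp: A.bracket_closed A.jacobian_closed lhom_bracket[OF hom] lhom_closed[OF hom]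
        lhom_jacobian[OF hom A.nonassoc_algebra_axioms] bracket_self jacobi)
  then have R: "lie_relators X \<subseteq> lcarrier ?A" and ker: "\<And>r. r \<in> lie_relators X \<Longrightarrow> \<phi> r = lzero L"
    by auto
  obtain \<psi> where "lhom (free_lie X) L \<psi>"
    "\<forall>f\<in>lcarrier ?A.
      \<psi> (lcoset ?A (generated_lideal ?A (lie_relators X)) f) = \<phi> f"
    unfolding free_lie_def
    by (rule A.lhom_lquotient_generated[OF R hom nonassoc_algebra_axioms ker])
  then show ?thesis
    by (intro that[of \<psi>]) (simp_all add: free_lie_gen_eq single_word_closed word)
qed

text \<open>
  A subset of the free Lie algebra that contains the generators and is closed under the operations
  is everything. This allows two homomorphisms to be compared on generators alone.
\<close>

lemma free_lie_induct [consumes 1, case_names zero gen add scale bracket]: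
  fixes X :: "'x set" and z :: "('x bword \<Rightarrow> 'a::{comm_ring,comm_monoid_mult}) set"
  assumes z: "z \<in> lcarrier (free_lie X)"
    and zero: "P (lzero (free_lie X))"
    and gen: "\<And>x. x \<in> X \<Longrightarrow> P (free_lie_gen X x)"
    and add: "\<And>y z. \<lbrakk>y \<in> lcarrier (free_lie X); z \<in> lcarrier (free_lie X); P y; P z\<rbrakk>
      \<Longrightarrow> P (ladd (free_lie X) y z)"
    and scale: "\<And>a z. \<lbrakk>z \<in> lcarrier (free_lie X); P z\<rbrakk> \<Longrightarrow> P (lscale (free_lie X) a z)"
    and bracket: "\<And>y z. \<lbrakk>y \<in> lcarrier (free_lie X); z \<in> lcarrier (free_lie X); P y; P z\<rbrakk>
      \<Longrightarrow> P (lbracket (free_lie X) y z)"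
  shows "P z"
proof -
  let ?A = "free_nonassoc X :: ('a, 'x bword \<Rightarrow> 'a) lalg"
  let ?q = "lcoset ?A (generated_lideal ?A (lie_relators X))"
  interpret A: nonassoc_algebra ?A
    by (rule nonassoc_algebra_free_nonassoc)
  have q: "lhom ?A (free_lie X) ?q"
    unfolding free_lie_def by (rule A.lhom_lcoset[OF lideal_free_lie])
  have word: "P (?q (single_word w))" if "letters w \<subseteq> X" for w
    using that
  proof (induction w)
    case (Letter x)
    then show ?case
      using gen[of x] by (simp add: free_lie_gen_eq)
  next
    case (Bracket u v)
    then have "P (lbracket (free_lie X) (?q (single_word u)) (?q (single_word v)))"
      by (intro bracket) (auto intro: lhom_closed[OF q] single_word_closed)
    with Bracket.prems show ?case
      by (simp add: lhom_bracket[OF q, symmetric] single_word_closed bracket_single_word)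
  qed
  from z obtain f where f: "f \<in> lcarrier ?A" and z_eq: "z = ?q f"
    unfolding free_lie_def A.lquotient_carrier_zero by blast
  from f have "P (?q f)"
  proof (induction rule: free_nonassoc_induct)
    case zero
    then show ?case
      using assms(2) by (simp add: free_lie_def lquotient_def)
  qed (auto simp: lhomD[OF q] intro!: add scale word)
  with z_eq show ?thesis by simp
qed

section \<open>Lyndon words\<close>

lemma append_less_append_left: "u @ v < u @ w \<longleftrightarrow> v < w"
  for u v w :: "'x::linorder list"
  by (induction u) auto

lemma less_append_self: "v \<noteq> [] \<Longrightarrow> u < u @ v"
  for u v :: "'x::linorder list"
  using append_less_append_left[of u "[]" v] by (cases v) auto

text \<open>
  Unless \<open>u\<close> is a prefix of \<open>v\<close>, the comparison is decided at a position inside both words,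
  so that arbitrary continuations do not affect it.
\<close>

lemma less_append_mono:
  fixes u v :: "'x::linorder list"
  assumes "u < v" "\<nexists>z. v = u @ z"
  shows "u @ x < v @ y"
  using assms
proof (induction u arbitrary: v)
  case (Cons a u)
  then show ?case by (cases v) auto
qed auto

lemma append_less_append_iff:
  fixes u u' :: "'x::linorder list"
  shows "length u = length u' \<Longrightarrow> u @ v < u' @ v' \<longleftrightarrow> u < u' \<or> u = u' \<and> v < v'"
  by (induction u u' rule: list_induct2) auto

definition lyndon :: "'x::linorder list \<Rightarrow> bool" where
  "lyndon w \<longleftrightarrow> w \<noteq> [] \<and> (\<forall>u v. w = u @ v \<longrightarrow> u \<noteq> [] \<longrightarrow> v \<noteq> [] \<longrightarrow> w < v)"

lemma lyndon_singleton: "lyndon [x]"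
  by (auto simp: lyndon_def Cons_eq_append_conv)

lemma lyndon_less_suffix: "lyndon w \<Longrightarrow> w = u @ v \<Longrightarrow> u \<noteq> [] \<Longrightarrow> v \<noteq> [] \<Longrightarrow> w < v"
  by (auto simp: lyndon_def)

lemma lyndon_append_less:
  assumes "lyndon v" "u < v" "u \<noteq> []"
  shows "u @ v < v"
proof (cases "\<exists>z. v = u @ z")
  case True
  then obtain z where z: "v = u @ z" by blast
  with assms(2) have "z \<noteq> []" by auto
  with z assms have "v < z"
    by (intro lyndon_less_suffix)
  with z show ?thesis
    using append_less_append_left[of u v z] by simp
next
  case False
  with less_append_mono[OF assms(2) False, of v "[]"] show ?thesis by simp
qed

lemma append_suffix_cases:
  assumes "u @ v = u' @ v'"
  obtains (outer) s where "s \<noteq> []" "u = u' @ s" "v' = s @ v"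
  | (same) "u' = u" "v' = v"
  | (inner) s where "s \<noteq> []" "u' = u @ s" "v = s @ v'"
proof -
  from assms obtain s where "u = u' @ s \<and> v' = s @ v \<or> u' = u @ s \<and> v = s @ v'"
    by (auto simp: append_eq_append_conv2)
  then show thesis
    using that by (cases "s = []") auto
qed

lemma lyndon_append:
  assumes u: "lyndon u" and v: "lyndon v" and "u < v"
  shows "lyndon (u @ v)"
  unfolding lyndon_def
proof (intro conjI allI impI)
  have "u \<noteq> []"
    using u by (simp add: lyndon_def)
  then show "u @ v \<noteq> []" by simp
  fix u' v' assume "u @ v = u' @ v'" "u' \<noteq> []" "v' \<noteq> []"
  then show "u @ v < v'"
  proof (cases rule: append_suffix_cases)
    case (outer s)
    then have "u < s"
      using u \<open>u' \<noteq> []\<close> by (intro lyndon_less_suffix)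
    moreover have "\<nexists>z. s = u @ z"
    proof
      assume "\<exists>z. s = u @ z"
      then have "length u \<le> length s" by auto
      with outer \<open>u' \<noteq> []\<close> show False by simp
    qed
    ultimately have "u @ v < s @ v"
      by (rule less_append_mono)
    with outer show ?thesis by simp
  next
    case same
    with lyndon_append_less[OF v \<open>u < v\<close> \<open>u \<noteq> []\<close>] show ?thesis by simp
  next
    case (inner s)
    then have "v < v'"
      using v \<open>v' \<noteq> []\<close> by (intro lyndon_less_suffix)
    with lyndon_append_less[OF v \<open>u < v\<close> \<open>u \<noteq> []\<close>] show ?thesis
      by (rule less_trans)
  qed
qed

text \<open>
  The standard factorization splits off the least proper suffix, which is also the longest proper
  suffix that is a Lyndon word.
\<close>

definition right_factor :: "'x::linorder list \<Rightarrow> 'x list" where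
  "right_factor w = Min {v. v \<noteq> [] \<and> (\<exists>u. u \<noteq> [] \<and> w = u @ v)}"

definition left_factor :: "'x::linorder list \<Rightarrow> 'x list" where
  "left_factor w = take (length w - length (right_factor w)) w"

lemma finite_proper_suffixes: "finite {v. v \<noteq> [] \<and> (\<exists>u. u \<noteq> [] \<and> w = u @ v)}"
  by (rule finite_subset[OF _ finite_lists_length_le[of "set w" "length w"]]) auto

lemma right_factor_least:
  "w = u @ v \<Longrightarrow> u \<noteq> [] \<Longrightarrow> v \<noteq> [] \<Longrightarrow> right_factor w \<le> v"
  unfolding right_factor_def by (rule Min_le[OF finite_proper_suffixes]) blast

lemma factorization:
  assumes "2 \<le> length w"
  shows "w = left_factor w @ right_factor w" "left_factor w \<noteq> []" "right_factor w \<noteq> []"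
proof -
  let ?S = "{v. v \<noteq> [] \<and> (\<exists>u. u \<noteq> [] \<and> w = u @ v)}"
  have "tl w \<in> ?S"
    using assms by (cases w) (auto intro!: exI[of _ "[hd w]"])
  then have "right_factor w \<in> ?S"
    unfolding right_factor_def by (intro Min_in finite_proper_suffixes) blast
  then obtain u where "u \<noteq> []" "w = u @ right_factor w" "right_factor w \<noteq> []"
    by auto
  moreover from this have "left_factor w = u"
    by (metis append_eq_conv_conj diff_add_inverse2 left_factor_def length_append)
  ultimately show "w = left_factor w @ right_factor w" "left_factor w \<noteq> []" "right_factor w \<noteq> []"
    by auto
qed

lemma length_factors:
  assumes "2 \<le> length w"
  shows "length (left_factor w) < length w" "length (right_factor w) < length w"
    "length w = length (left_factor w) + length (right_factor w)"
proof -
  show *: "length w = length (left_factor w) + length (right_factor w)"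
    using factorization(1)[OF assms] by (metis length_append)
  show "length (left_factor w) < length w" "length (right_factor w) < length w"
    using factorization(2,3)[OF assms] * by (simp_all add: *)
qed

lemma lyndon_right_factor:
  assumes "2 \<le> length w"
  shows "lyndon (right_factor w)"
  unfolding lyndon_def
proof (intro conjI allI impI)
  show "right_factor w \<noteq> []"
    by (rule factorization[OF assms])
  fix u v assume *: "right_factor w = u @ v" "u \<noteq> []" "v \<noteq> []"
  then have "w = (left_factor w @ u) @ v"
    using factorization(1)[OF assms] by simp
  then have "right_factor w \<le> v"
    by (rule right_factor_least) (use * in auto)
  moreover have "right_factor w \<noteq> v"
    using * by auto
  ultimately show "right_factor w < v" by simp
qed

text \<open>
  A proper suffix \<open>s\<close> of the left factor with \<open>s\<close> not greater than it would either produce a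
  proper suffix of \<open>w\<close> below the least one, if \<open>s\<close> is also a prefix, or make the suffix
  \<open>s @ right_factor w\<close> smaller than the Lyndon word \<open>w\<close>.
\<close>

lemma lyndon_left_factor:
  assumes w: "lyndon w" and len: "2 \<le> length w"
  shows "lyndon (left_factor w)"
  unfolding lyndon_def
proof (intro conjI allI impI)
  let ?u = "left_factor w" and ?v = "right_factor w"
  note w_eq = factorization(1)[OF len]
  show "?u \<noteq> []"
    by (rule factorization[OF len])
  fix r s assume u: "?u = r @ s" and "r \<noteq> []" "s \<noteq> []"
  show "?u < s"
  proof (rule ccontr)
    assume "\<not> ?u < s"
    moreover have "s \<noteq> ?u"
      using u \<open>r \<noteq> []\<close> by auto
    ultimately have "s < ?u" by simp
    have "w < s @ ?v"
      using w_eq u \<open>r \<noteq> []\<close> \<open>s \<noteq> []\<close> by (intro lyndon_less_suffix[OF w, of r]) auto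
    show False
    proof (cases "\<exists>z. ?u = s @ z")
      case True
      then obtain z where z: "?u = s @ z" by blast
      have "s @ z @ ?v < s @ ?v"
        using \<open>w < s @ ?v\<close> w_eq z by simp
      then have "z @ ?v < ?v"
        by (simp add: append_less_append_left)
      moreover have "?v \<le> z @ ?v"
        using w_eq z \<open>s \<noteq> []\<close> factorization(3)[OF len] by (intro right_factor_least[of w s]) auto
      ultimately show False by simp
    next
      case False
      have "s @ ?v < ?u @ ?v"
        by (rule less_append_mono[OF \<open>s < ?u\<close> False])
      with \<open>w < s @ ?v\<close> w_eq show False by simp
    qed
  qed
qed

lemma left_factor_less_right_factor:
  assumes w: "lyndon w" and len: "2 \<le> length w"
  shows "left_factor w < right_factor w"
proof -
  have "left_factor w < left_factor w @ right_factor w"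
    using factorization(3)[OF len] by (rule less_append_self)
  moreover have "w < right_factor w"
    by (rule lyndon_less_suffix[OF w factorization[OF len]])
  ultimately show ?thesis
    using factorization(1)[OF len] by simp
qed

text \<open>
  This tells when the bracket of two Lyndon elements is again a Lyndon element: every longer suffix
  of \<open>u @ v\<close> starts with a suffix of \<open>u\<close>, and the least of these is the right factor of \<open>u\<close>.
\<close>

lemma factors_append:
  assumes u: "lyndon u" and v: "lyndon v"
    and std: "length u = 1 \<or> v \<le> right_factor u"
  shows "left_factor (u @ v) = u" "right_factor (u @ v) = v"
proof -
  have ne: "u \<noteq> []" "v \<noteq> []"
    using u v by (auto simp: lyndon_def)
  show v_eq: "right_factor (u @ v) = v"
    unfolding right_factor_def
  proof (rule Min_eqI[OF finite_proper_suffixes])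
    show "v \<in> {v'. v' \<noteq> [] \<and> (\<exists>u'. u' \<noteq> [] \<and> u @ v = u' @ v')}"
      using ne by blast
    fix v' assume "v' \<in> {v'. v' \<noteq> [] \<and> (\<exists>u'. u' \<noteq> [] \<and> u @ v = u' @ v')}"
    then obtain u' where "u @ v = u' @ v'" and ne': "u' \<noteq> []" "v' \<noteq> []" by blast
    then show "v \<le> v'"
    proof (cases rule: append_suffix_cases)
      case (outer s)
      then have "length u \<noteq> 1"
        using ne' by (cases u') auto
      with std have "v \<le> right_factor u" by simp
      also have "\<dots> \<le> s"
        using outer ne' by (intro right_factor_least)
      also have "\<dots> \<le> v'"
        using outer less_append_self[OF ne(2), of s] by simp
      finally show ?thesis .
    next
      case (inner s)
      then have "v < v'"
        using ne' by (intro lyndon_less_suffix[OF v])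
      then show ?thesis by simp
    qed auto
  qed
  show "left_factor (u @ v) = u"
    by (simp add: left_factor_def v_eq)
qed

function lyndon_tree :: "'x::linorder list \<Rightarrow> 'x bword" where
  "lyndon_tree w =
    (if length w < 2 then Letter (hd w)
     else Bracket (lyndon_tree (left_factor w)) (lyndon_tree (right_factor w)))"
  by auto
termination
  by (relation "measure length") (simp_all add: length_factors(1,2) not_less)

declare lyndon_tree.simps [simp del]

lemma lyndon_tree_singleton: "lyndon_tree [x] = Letter x"
  by (simp add: lyndon_tree.simps)

lemma lyndon_tree_factors:
  "2 \<le> length w \<Longrightarrow>
    lyndon_tree w = Bracket (lyndon_tree (left_factor w)) (lyndon_tree (right_factor w))"
  by (simp add: lyndon_tree.simps[of w])

lemma lyndon_induct [consumes 1, case_names letter factors]: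
  assumes "lyndon w"
    and "\<And>x. P [x]"
    and "\<And>w. \<lbrakk>lyndon w; 2 \<le> length w; lyndon (left_factor w); lyndon (right_factor w);
      P (left_factor w); P (right_factor w)\<rbrakk> \<Longrightarrow> P w"
  shows "P w"
  using assms(1)
proof (induction "length w" arbitrary: w rule: less_induct)
  case less
  show ?case
  proof (cases "2 \<le> length w")
    case True
    show ?thesis
    proof (rule assms(3)[OF less.prems True])
      show *: "lyndon (left_factor w)" "lyndon (right_factor w)"
        using less.prems True by (simp_all add: lyndon_left_factor lyndon_right_factor)
      show "P (left_factor w)" "P (right_factor w)"
        using length_factors(1,2)[OF True] * by (simp_all add: less.hyps)
    qed
  next
    case False
    with less.prems obtain x where "w = [x]"
      by (cases w rule: remdups_adj.cases) (auto simp: lyndon_def)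
    with assms(2) show ?thesis by simp
  qed
qed

lemma letters_lyndon_tree: "lyndon w \<Longrightarrow> letters (lyndon_tree w) = set w"
proof (induction rule: lyndon_induct)
  case (factors w)
  then show ?case
    by (simp add: lyndon_tree_factors) (metis factorization(1) set_append)
qed (simp add: lyndon_tree_singleton)

lemma length_lyndon_tree: "lyndon w \<Longrightarrow> bword_length (lyndon_tree w) = length w"
proof (induction rule: lyndon_induct)
  case (factors w)
  then show ?case
    using length_factors(3)[of w] by (simp add: lyndon_tree_factors)
qed (simp add: lyndon_tree_singleton)

section \<open>Lyndon elements span the free Lie algebra\<close>

inductive_set lspan :: "('a::{comm_ring,comm_monoid_mult}, 'v) lalg \<Rightarrow> 'v set \<Rightarrow> 'v set"
  for L B where
  zero: "lzero L \<in> lspan L B"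
| base: "b \<in> B \<Longrightarrow> b \<in> lspan L B"
| add: "\<lbrakk>x \<in> lspan L B; y \<in> lspan L B\<rbrakk> \<Longrightarrow> ladd L x y \<in> lspan L B"
| scale: "x \<in> lspan L B \<Longrightarrow> lscale L a x \<in> lspan L B"

lemma lspan_mono: "B \<subseteq> C \<Longrightarrow> x \<in> lspan L B \<Longrightarrow> x \<in> lspan L C"
  by (rotate_tac, induction rule: lspan.induct) (auto intro: lspan.intros)

context nonassoc_algebra
begin

lemma lspan_closed: "x \<in> lspan L B \<Longrightarrow> B \<subseteq> lcarrier L \<Longrightarrow> x \<in> lcarrier L"
  by (induction rule: lspan.induct) (auto simp: zero_closed add_closed scale_closed)

lemma lspan_bracket_left:
  assumes x: "x \<in> lspan L B" and B: "B \<subseteq> lcarrier L" and y: "y \<in> lcarrier L"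
    and base: "\<And>b. b \<in> B \<Longrightarrow> lbracket L b y \<in> lspan L C"
  shows "lbracket L x y \<in> lspan L C"
  using x
  by induction
    (simp_all add: bracket_zero_left bracket_add_left bracket_scale_left lspan_closed[OF _ B] y
      lspan.intros base)

end

context lie_algebra
begin

lemma bracket_antisym:
  assumes "x \<in> lcarrier L" "y \<in> lcarrier L"
  shows "lbracket L y x = lscale L (- 1) (lbracket L x y)"
proof -
  have "lbracket L (ladd L x y) (ladd L x y) = ladd L (lbracket L x y) (lbracket L y x)"
    using assms
    by (simp add: bracket_add_left bracket_add_right add_closed bracket_closed
        bracket_self[of x] bracket_self[of y] add_zero add_zero_right
        add_comm[of "lbracket L y x"])
  then have "ladd L (lbracket L x y) (lbracket L y x) = lzero L"
    using assms by (simp add: bracket_self add_closed)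
  then show ?thesis
    by (rule add_eq_zero_imp[rotated 2]) (simp_all add: assms bracket_closed)
qed

lemma bracket_derivation:
  assumes "x \<in> lcarrier L" "y \<in> lcarrier L" "z \<in> lcarrier L"
  shows "lbracket L (lbracket L x y) z =
    ladd L (lbracket L (lbracket L x z) y) (lbracket L x (lbracket L y z))"
proof -
  have "lbracket L (lbracket L y z) x = lscale L (- 1) (lbracket L x (lbracket L y z))"
    using assms by (intro bracket_antisym) (simp_all add: bracket_closed)
  moreover have "lbracket L (lbracket L z x) y = lscale L (- 1) (lbracket L (lbracket L x z) y)"
    using assms by (simp add: bracket_antisym[of x z] bracket_scale_left bracket_closed)
  ultimately have "ladd L (lbracket L (lbracket L x y) z) (lscale L (- 1)
      (ladd L (lbracket L (lbracket L x z) y) (lbracket L x (lbracket L y z)))) = lzero L"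
    using jacobi[OF assms] assms
    by (simp add: jacobian_def scale_add_right bracket_closed scale_closed
        add_comm[of "lscale L (- 1) (lbracket L x (lbracket L y z))"])
  then show ?thesis
    by (rule add_minus_eq_zero_imp[rotated 2]) (simp_all add: assms bracket_closed add_closed)
qed

lemma lspan_bracket_commute:
  assumes "lbracket L x y \<in> lspan L B" "x \<in> lcarrier L" "y \<in> lcarrier L"
  shows "lbracket L y x \<in> lspan L B"
  using assms by (simp add: bracket_antisym[of x y] lspan.scale)

end

definition lyndon_words :: "'x::linorder set \<Rightarrow> 'x list set" where
  "lyndon_words X = {w. lyndon w \<and> set w \<subseteq> X}"

abbreviation lyndon_element :: "('a, 'v) lalg \<Rightarrow> ('x::linorder \<Rightarrow> 'v) \<Rightarrow> 'x list \<Rightarrow> 'v" where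
  "lyndon_element L g w \<equiv> commutator L g (lyndon_tree w)"

lemma lyndon_words_factors:
  assumes "w \<in> lyndon_words X" "2 \<le> length w"
  shows "left_factor w \<in> lyndon_words X" "right_factor w \<in> lyndon_words X"
proof -
  have "set (left_factor w) \<union> set (right_factor w) \<subseteq> X"
    using assms factorization(1)[of w] unfolding lyndon_words_def
    by (metis (mono_tags, lifting) mem_Collect_eq set_append)
  then show "left_factor w \<in> lyndon_words X" "right_factor w \<in> lyndon_words X"
    using assms by (auto simp: lyndon_words_def lyndon_left_factor lyndon_right_factor)
qed

lemma (in lie_algebra) lyndon_element_closed:
  assumes "g ` X \<subseteq> lcarrier L" "w \<in> lyndon_words X"
  shows "lyndon_element L g w \<in> lcarrier L"
  using assms by (intro commutator_closed) (auto simp: lyndon_words_def letters_lyndon_tree)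

text \<open>
  If \<open>(u, v)\<close> is the standard factorization of \<open>u @ v\<close>, the bracket is a Lyndon element.
  Otherwise \<open>u\<close> factors as \<open>(u1, u2)\<close> with \<open>u2 < v\<close>, and
  \<open>[[u1, u2], v] = [[u1, v], u2] + [u1, [u2, v]]\<close>. By induction on the total length the inner
  brackets are combinations of Lyndon elements of words below \<open>v\<close>, so the outer brackets that
  arise have the same total length but involve only words below \<open>v\<close>. The bound \<open>w < v\<close> in the
  conclusion is what makes this second induction, on the larger word, go through; it terminates
  because there are finitely many words of bounded length over a finite alphabet.
\<close>

lemma (in lie_algebra) bracket_lyndon_elements:
  fixes X :: "'x::linorder set"
  assumes fin: "finite X" and g: "g ` X \<subseteq> lcarrier L"
    and "u \<in> lyndon_words X" "v \<in> lyndon_words X" "u < v"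
  shows "lbracket L (lyndon_element L g u) (lyndon_element L g v) \<in>
    lspan L (lyndon_element L g `
      {w \<in> lyndon_words X. length w = length u + length v \<and> w < v})"
  using assms(3-5)
proof (induction "length u + length v" arbitrary: u v rule: less_induct)
  case outer: less
  define N where "N = length u + length v"
  let ?P = "lyndon_element L g"
  define B where "B n v = ?P ` {w \<in> lyndon_words X. length w = n \<and> w < v}" for n v
  \<comment> \<open>The size of \<open>below v\<close> is the measure of the inner induction.\<close>
  define below where "below v = {w. set w \<subseteq> X \<and> length w \<le> N} \<inter> {w. w < v}" for v
  note P_closed = lyndon_element_closed[OF g]
  have B_closed: "B n v \<subseteq> lcarrier L" for n v
    by (auto simp: B_def intro: P_closed)
  have B_mono: "B n v \<subseteq> B n v'" if "v < v'" for n v v'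
    using that by (auto simp: B_def)
  have fin_below: "finite (below v)" for v
    using finite_lists_length_le[OF fin, of N] by (simp add: below_def)
  have below: "card (below w) < card (below v)"
    if "w < v" "set w \<subseteq> X" "length w \<le> N" for v w
  proof (rule psubset_card_mono[OF fin_below])
    show "below w \<subset> below v"
      using that by (auto simp: below_def)
  qed
  have IH: "lbracket L (?P a) (?P b) \<in> lspan L (B (length a + length b) b)"
    if "length a + length b < N" "a \<in> lyndon_words X" "b \<in> lyndon_words X" "a < b" for a b
    using outer.hyps[of a b] that by (simp add: N_def B_def)
  have "lbracket L (?P u) (?P v) \<in> lspan L (B N v)"
    if "length u + length v = N" "u \<in> lyndon_words X" "v \<in> lyndon_words X" "u < v" for u v
    using that
  proof (induction "card (below v)" arbitrary: u v rule: less_induct)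
    case inner: less
    note u = inner.prems(2) and v = inner.prems(3)
    have lyndon: "lyndon u" "lyndon v"
      using u v by (auto simp: lyndon_words_def)
    have le_v: "lbracket L (?P a) (?P b) \<in> lspan L (B N v)"
      if "length a + length b = N" "a \<in> lyndon_words X" "b \<in> lyndon_words X" "a < b" "b < v" for a b
    proof -
      have "card (below b) < card (below v)"
        using that by (intro below) (auto simp: lyndon_words_def)
      then have "lbracket L (?P a) (?P b) \<in> lspan L (B N b)"
        using that by (intro inner.hyps)
      then show ?thesis
        by (rule lspan_mono[OF B_mono[OF \<open>b < v\<close>]])
    qed
    \<comment> \<open>The hypothesis of the inner induction, freed from the order of the two words.\<close>
    have both_less: "lbracket L (?P a) (?P b) \<in> lspan L (B N v)"
      if "length a + length b = N" "a \<in> lyndon_words X" "b \<in> lyndon_words X" "a < v" "b < v" for a b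
    proof (cases a b rule: linorder_cases)
      case less
      with that show ?thesis by (intro le_v)
    next
      case equal
      with that show ?thesis
        by (simp add: bracket_self P_closed lspan.zero)
    next
      case greater
      with that have "lbracket L (?P b) (?P a) \<in> lspan L (B N v)"
        by (intro le_v) simp_all
      with that show ?thesis
        by (intro lspan_bracket_commute[of "?P b"]) (auto intro: P_closed)
    qed
    show ?case
    proof (cases "length u = 1 \<or> v \<le> right_factor u")
      case True
      have "2 \<le> length (u @ v)"
        using lyndon by (cases u; cases v) (auto simp: lyndon_def)
      then have "?P (u @ v) = lbracket L (?P u) (?P v)"
        using factors_append[OF lyndon True] by (simp add: lyndon_tree_factors)
      moreover have "u @ v < v"
        using lyndon inner.prems(4) by (intro lyndon_append_less) (auto simp: lyndon_def)
      then have "?P (u @ v) \<in> B N v"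
        using inner.prems lyndon_append[OF lyndon] by (auto simp: B_def lyndon_words_def)
      ultimately show ?thesis
        by (metis lspan.base)
    next
      case False
      define u1 u2 where "u1 = left_factor u" and "u2 = right_factor u"
      have "length u \<noteq> 0"
        using lyndon by (simp add: lyndon_def)
      with False have len: "2 \<le> length u" by linarith
      have mem: "u1 \<in> lyndon_words X" "u2 \<in> lyndon_words X"
        using lyndon_words_factors[OF u len] by (simp_all add: u1_def u2_def)
      have less: "u1 < u2" "u2 < v"
        using False left_factor_less_right_factor[OF lyndon(1) len]
        by (auto simp: u1_def u2_def)
      then have "u1 < v" by simp
      have length: "length u1 + length v < N" "length u2 + length v < N"
        "length u1 + length u2 + length v = N"
        using length_factors[OF len] inner.prems(1) unfolding u1_def u2_def by linarith+
      note closed = P_closed[OF mem(1)] P_closed[OF mem(2)] P_closed[OF v]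
      have "lbracket L (?P u1) (?P v) \<in> lspan L (B (length u1 + length v) v)"
        using IH[OF length(1) mem(1) v] \<open>u1 < v\<close> by simp
      then have "lbracket L (lbracket L (?P u1) (?P v)) (?P u2) \<in> lspan L (B N v)"
      proof (rule lspan_bracket_left[OF _ B_closed closed(2)])
        fix b assume "b \<in> B (length u1 + length v) v"
        then obtain w where "b = ?P w" "w \<in> lyndon_words X" "length w = length u1 + length v" "w < v"
          by (auto simp: B_def)
        then show "lbracket L b (?P u2) \<in> lspan L (B N v)"
          using both_less[of w u2] length(3) less mem by simp
      qed
      moreover have "lbracket L (?P u2) (?P v) \<in> lspan L (B (length u2 + length v) v)"
        using IH[OF length(2) mem(2) v less(2)] .
      then have "lbracket L (lbracket L (?P u2) (?P v)) (?P u1) \<in> lspan L (B N v)"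
      proof (rule lspan_bracket_left[OF _ B_closed closed(1)])
        fix b assume "b \<in> B (length u2 + length v) v"
        then obtain w where "b = ?P w" "w \<in> lyndon_words X" "length w = length u2 + length v" "w < v"
          by (auto simp: B_def)
        then show "lbracket L b (?P u1) \<in> lspan L (B N v)"
          using both_less[of w u1] length(3) \<open>u1 < v\<close> mem by simp
      qed
      then have "lbracket L (?P u1) (lbracket L (?P u2) (?P v)) \<in> lspan L (B N v)"
        by (rule lspan_bracket_commute) (simp_all add: closed bracket_closed)
      moreover have "?P u = lbracket L (?P u1) (?P u2)"
        using len by (simp add: lyndon_tree_factors u1_def u2_def)
      ultimately show ?thesis
        by (simp add: bracket_derivation[OF closed] lspan.add)
    qed
  qed
  from this[OF N_def[symmetric] outer.prems] show ?case
    by (simp add: B_def N_def)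
qed

lemma free_lie_spanned_by_lyndon_elements:
  fixes X :: "'x::linorder set"
  assumes fin: "finite X" and z: "z \<in> lcarrier (free_lie X)"
  shows "z \<in> lspan (free_lie X) (lyndon_element (free_lie X) (free_lie_gen X) ` lyndon_words X)"
  using z
proof (induction rule: free_lie_induct)
  let ?F = "free_lie X" and ?P = "lyndon_element (free_lie X) (free_lie_gen X)"
  let ?B = "?P ` lyndon_words X"
  interpret lie_algebra ?F
    by (rule lie_algebra_free_lie)
  have gen_closed: "free_lie_gen X ` X \<subseteq> lcarrier ?F"
    by (auto intro: free_lie_gen_closed)
  have closed: "?P w \<in> lcarrier ?F" if "w \<in> lyndon_words X" for w
    using that by (intro lyndon_element_closed[OF gen_closed])
  then have B: "?B \<subseteq> lcarrier ?F" by auto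
  {
    case (gen x)
    then have "[x] \<in> lyndon_words X"
      by (simp add: lyndon_words_def lyndon_singleton)
    then have "?P [x] \<in> lspan ?F ?B"
      by (intro lspan.base imageI)
    then show ?case
      by (simp add: lyndon_tree_singleton)
  next
    case (bracket y z)
    have ordered: "lbracket ?F (?P u) (?P v) \<in> lspan ?F ?B"
      if "u \<in> lyndon_words X" "v \<in> lyndon_words X" "u < v" for u v
      using bracket_lyndon_elements[OF fin gen_closed that]
      by (rule lspan_mono[rotated]) auto
    have pair: "lbracket ?F (?P u) (?P v) \<in> lspan ?F ?B"
      if "u \<in> lyndon_words X" "v \<in> lyndon_words X" for u v
    proof (cases u v rule: linorder_cases)
      case less
      with that show ?thesis by (rule ordered)
    next
      case equal
      with that show ?thesis
        by (simp add: bracket_self closed lspan.zero)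
    next
      case greater
      with that show ?thesis
        by (intro lspan_bracket_commute[of "?P v"] ordered closed)
    qed
    have "lbracket ?F (?P u) y \<in> lspan ?F ?B" if "u \<in> lyndon_words X" for u
    proof (rule lspan_bracket_commute[OF lspan_bracket_left[OF bracket(3) B closed[OF that]]])
      show "lbracket ?F b (?P u) \<in> lspan ?F ?B" if "b \<in> ?B" for b
        using that \<open>u \<in> _\<close> by (auto intro: pair)
    qed (use bracket that in \<open>auto intro: closed\<close>)
    then have "lbracket ?F z y \<in> lspan ?F ?B"
      using bracket by (intro lspan_bracket_left[OF bracket(4) B]) auto
    then show ?case
      using bracket by (intro lspan_bracket_commute[of z])
  }
qed (auto intro: lspan.intros)

section \<open>Linear maps under the commutator bracket\<close>

definition linear_maps ::
    "('a::{comm_ring,comm_monoid_mult}, ('i \<Rightarrow> 'a) \<Rightarrow> 'i \<Rightarrow> 'a) lalg" where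
  "linear_maps =
     \<lparr>lcarrier = {T. (\<forall>f g. T (\<lambda>i. f i + g i) = (\<lambda>i. T f i + T g i)) \<and>
        (\<forall>c f. T (\<lambda>i. c * f i) = (\<lambda>i. c * T f i))},
      lzero = (\<lambda>f i. 0),
      ladd = (\<lambda>S T f i. S f i + T f i),
      lscale = (\<lambda>c T f i. c * T f i),
      lbracket = (\<lambda>S T f i. S (T f) i - T (S f) i)\<rparr>"

lemma linear_maps_simps:
  "lzero linear_maps = (\<lambda>f i. 0)"
  "ladd linear_maps S T = (\<lambda>f i. S f i + T f i)"
  "lscale linear_maps c T = (\<lambda>f i. c * T f i)"
  "lbracket linear_maps S T = (\<lambda>f i. S (T f) i - T (S f) i)"
  by (simp_all add: linear_maps_def)

lemma linear_mapsI:
  assumes "\<And>f g. T (\<lambda>i. f i + g i) = (\<lambda>i. T f i + T g i)"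
    and "\<And>c f. T (\<lambda>i. c * f i) = (\<lambda>i. c * T f i)"
  shows "T \<in> lcarrier linear_maps"
  using assms by (simp add: linear_maps_def)

lemma linear_maps_add: "T \<in> lcarrier linear_maps \<Longrightarrow> T (\<lambda>i. f i + g i) = (\<lambda>i. T f i + T g i)"
  and linear_maps_scale: "T \<in> lcarrier linear_maps \<Longrightarrow> T (\<lambda>i. c * f i) = (\<lambda>i. c * T f i)"
  by (simp_all add: linear_maps_def)

lemma linear_maps_diff:
  assumes "T \<in> lcarrier linear_maps"
  shows "T (\<lambda>i. f i - g i) = (\<lambda>i. T f i - T g i)"
  using linear_maps_add[OF assms, of f "\<lambda>i. - 1 * g i"] linear_maps_scale[OF assms, of "- 1" g]
  by simp

lemma linear_maps_zero:
  assumes "T \<in> lcarrier linear_maps"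
  shows "T (\<lambda>i. 0) = (\<lambda>i. 0)"
  using linear_maps_scale[OF assms, of 0 "\<lambda>i. 0"] by simp

lemma lie_algebra_linear_maps: "lie_algebra linear_maps"
proof
  show "lbracket linear_maps S T \<in> lcarrier linear_maps"
    if "S \<in> lcarrier linear_maps" "T \<in> lcarrier linear_maps" for S T :: "('i \<Rightarrow> 'a) \<Rightarrow> 'i \<Rightarrow> 'a"
    using that
    by (intro linear_mapsI)
      (simp_all add: linear_maps_simps linear_maps_add linear_maps_scale algebra_simps)
  show "jacobian linear_maps R S T = lzero linear_maps"
    if "R \<in> lcarrier linear_maps" "S \<in> lcarrier linear_maps" "T \<in> lcarrier linear_maps"
    for R S T :: "('i \<Rightarrow> 'a) \<Rightarrow> 'i \<Rightarrow> 'a"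
    using that by (simp add: jacobian_def linear_maps_simps linear_maps_diff fun_eq_iff)
qed (auto intro!: linear_mapsI simp: linear_maps_simps linear_maps_add linear_maps_scale
    linear_maps_zero fun_eq_iff algebra_simps)

definition prepend :: "'x \<Rightarrow> ('x list \<Rightarrow> 'a) \<Rightarrow> 'x list \<Rightarrow> 'a::{comm_ring,comm_monoid_mult}" where
  "prepend x f q = (case q of [] \<Rightarrow> 0 | y # p \<Rightarrow> if y = x then f p else 0)"

lemma prepend_simps:
  "prepend x f [] = 0"
  "prepend x f (y # p) = (if y = x then f p else 0)"
  by (simp_all add: prepend_def)

lemma prepend_closed: "prepend x \<in> lcarrier linear_maps"
  by (rule linear_mapsI) (auto simp: prepend_def fun_eq_iff split: list.split)

text \<open>
  Expanding a commutator of operators that each prepend one letter gives products that prepend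
  words with the same letters. The predicate \<open>Q\<close> records at which lengths an operator may act; it
  is trivial for free prepending and a congruence for the representation of the quotient.
\<close>

lemma commutator_support:
  fixes X :: "'x \<Rightarrow> ('x list \<Rightarrow> 'a) \<Rightarrow> 'x list \<Rightarrow> 'a::{comm_ring,comm_monoid_mult}"
  assumes gen: "\<forall>x f q. X x f q \<noteq> 0 \<longrightarrow> (\<exists>r. q = x # r \<and> f r \<noteq> 0 \<and> Q x (length q))"
    and "commutator linear_maps X t f q \<noteq> 0"
  obtains p r where "q = p @ r" "length p = bword_length t" "set p = letters t" "f r \<noteq> 0"
    "\<forall>j<length p. Q (p ! j) (length q - j)"
proof -
  have "\<exists>p r. q = p @ r \<and> length p = bword_length t \<and> set p = letters t \<and> f r \<noteq> 0 \<and>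
      (\<forall>j<length p. Q (p ! j) (length q - j))"
    using assms(2)
  proof (induction t arbitrary: f q)
    case (Letter x)
    then have "X x f q \<noteq> 0" by simp
    from gen[rule_format, OF this] obtain r where "q = x # r" "f r \<noteq> 0" "Q x (length q)"
      by blast
    then show ?case
      by (intro exI[of _ "[x]"] exI[of _ r]) auto
  next
    case (Bracket s t)
    have product: "\<exists>p r. q = p @ r \<and> length p = bword_length a + bword_length b \<and>
        set p = letters a \<union> letters b \<and> f r \<noteq> 0 \<and> (\<forall>j<length p. Q (p ! j) (length q - j))"
      if nz: "commutator linear_maps X a (commutator linear_maps X b f) q \<noteq> 0"
        and IHa: "\<And>f q. commutator linear_maps X a f q \<noteq> 0 \<Longrightarrow>
          \<exists>p r. q = p @ r \<and> length p = bword_length a \<and> set p = letters a \<and> f r \<noteq> 0 \<and>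
            (\<forall>j<length p. Q (p ! j) (length q - j))"
        and IHb: "\<And>f q. commutator linear_maps X b f q \<noteq> 0 \<Longrightarrow>
          \<exists>p r. q = p @ r \<and> length p = bword_length b \<and> set p = letters b \<and> f r \<noteq> 0 \<and>
            (\<forall>j<length p. Q (p ! j) (length q - j))" for a b
    proof -
      obtain p1 r1 where 1: "q = p1 @ r1" "length p1 = bword_length a" "set p1 = letters a"
        "commutator linear_maps X b f r1 \<noteq> 0" "\<forall>j<length p1. Q (p1 ! j) (length q - j)"
        using IHa[OF nz] by blast
      obtain p2 r where 2: "r1 = p2 @ r" "length p2 = bword_length b" "set p2 = letters b"
        "f r \<noteq> 0" "\<forall>j<length p2. Q (p2 ! j) (length r1 - j)"
        using IHb[OF 1(4)] by blast
      have "Q ((p1 @ p2) ! j) (length q - j)" if "j < length (p1 @ p2)" for j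
      proof (cases "j < length p1")
        case True
        with 1(5) show ?thesis by (simp add: nth_append)
      next
        case False
        with that have "j - length p1 < length p2" by simp
        with 2(5) have "Q (p2 ! (j - length p1)) (length r1 - (j - length p1))" by blast
        moreover have "length r1 - (j - length p1) = length q - j"
          using False 1(1) by simp
        ultimately show ?thesis
          using False by (simp add: nth_append)
      qed
      with 1 2 show ?thesis
        by (intro exI[of _ "p1 @ p2"] exI[of _ r]) auto
    qed
    let ?S = "commutator linear_maps X s" and ?T = "commutator linear_maps X t"
    from Bracket.prems have "?S (?T f) q \<noteq> 0 \<or> ?T (?S f) q \<noteq> 0"
      by (auto simp: linear_maps_simps)
    then show ?case
    proof
      assume "?S (?T f) q \<noteq> 0"
      from product[OF this Bracket.IH] show ?thesis by simp
    next
      assume "?T (?S f) q \<noteq> 0"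
      from product[OF this Bracket.IH(2,1)] show ?thesis by (simp add: Un_commute add.commute)
    qed
  qed
  with that show thesis by blast
qed

section \<open>Lyndon elements are linearly independent\<close>

abbreviation prepend_commutator ::
    "'x bword \<Rightarrow> ('x list \<Rightarrow> 'a::{comm_ring,comm_monoid_mult}) \<Rightarrow> 'x list \<Rightarrow> 'a" where
  "prepend_commutator \<equiv> commutator linear_maps prepend"

text \<open>
  Together with \<open>commutator_support\<close> this says that the commutator acts as left multiplication by
  \<open>w\<close> plus a combination of larger words of the same length. For \<open>w = u @ v\<close> the product of the two factors has leading word
  \<open>u @ v\<close>, whereas the product in the opposite order starts at \<open>v @ u\<close>, which is larger than
  \<open>w\<close> because \<open>w\<close> is a Lyndon word.
\<close>

lemma lyndon_leading_word:
  fixes f :: "'x::linorder list \<Rightarrow> 'a::{comm_ring,comm_monoid_mult}"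
  assumes "lyndon w"
  shows "prepend_commutator (lyndon_tree w) f (w @ p) = f p"
    and "\<lbrakk>length v = length w; v < w\<rbrakk> \<Longrightarrow> prepend_commutator (lyndon_tree w) f (v @ p) = 0"
  using assms
proof (induction arbitrary: f p v rule: lyndon_induct)
  case (letter x)
  {
    case 1
    show ?case by (simp add: lyndon_tree_singleton prepend_simps)
  next
    case 2
    then show ?case by (cases v) (auto simp: lyndon_tree_singleton prepend_simps)
  }
next
  case (factors w)
  let ?u = "left_factor w" and ?v = "right_factor w"
  let ?U = "prepend_commutator (lyndon_tree ?u) :: _ \<Rightarrow> _ \<Rightarrow> 'a"
    and ?V = "prepend_commutator (lyndon_tree ?v) :: _ \<Rightarrow> _ \<Rightarrow> 'a"
  note w_eq = factorization(1)[OF factors(2)] and len = length_factors(3)[OF factors(2)]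
  have swap: "w < ?v @ ?u"
  proof -
    have "w < ?v"
      using lyndon_less_suffix[OF factors(1) factorization[OF factors(2)]] .
    also have "?v < ?v @ ?u"
      using factorization(2)[OF factors(2)] by (rule less_append_self)
    finally show ?thesis .
  qed
  have below: "A (B f) (r @ p) = 0"
    if "\<And>f p r. length r = length a \<Longrightarrow> r < a \<Longrightarrow> A f (r @ p) = 0"
      and "\<And>f p. A f (a @ p) = f p"
      and "\<And>f p r. length r = length b \<Longrightarrow> r < b \<Longrightarrow> B f (r @ p) = 0"
      and "length r = length a + length b" "r < a @ b"
    for A B :: "('x list \<Rightarrow> 'a) \<Rightarrow> 'x list \<Rightarrow> 'a" and a b r p f
  proof -
    define r1 r2 where "r1 = take (length a) r" and "r2 = drop (length a) r"
    have r: "r = r1 @ r2" "length r1 = length a" "length r2 = length b"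
      using that(4) by (simp_all add: r1_def r2_def)
    with that(5) have "r1 < a \<or> r1 = a \<and> r2 < b"
      by (simp add: append_less_append_iff)
    with r that(1,2,3) show ?thesis by auto
  qed
  have tree: "prepend_commutator (lyndon_tree w) f q = ?U (?V f) q - ?V (?U f) q" for f q
    using factors(2) by (simp add: lyndon_tree_factors linear_maps_simps)
  have VU: "?V (?U f) (r @ p) = 0" if "length r = length w" "r < ?v @ ?u" for f r p
    using factors that len by (intro below[of ?v ?V ?u ?U]) auto
  {
    case 1
    have "?U (?V f) ((?u @ ?v) @ p) = f p"
      using factors by simp
    then show ?case
      using VU[of w f p] swap w_eq by (simp add: tree)
  next
    case 2
    then have "?U (?V f) (v @ p) = 0"
      using factors len w_eq by (intro below[of ?u ?U ?v ?V]) auto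
    moreover have "v < ?v @ ?u"
      using 2 swap by simp
    ultimately show ?case
      using VU[of v f p] 2 by (simp add: tree)
  }
qed

context nonassoc_algebra
begin

lemma lspan_empty: "x \<in> lspan L {} \<Longrightarrow> x = lzero L"
  by (induction rule: lspan.induct) (auto simp: add_zero zero_closed scale_zero_right)

lemma lspan_insert:
  assumes x: "x \<in> lspan L (insert b B)" and b: "b \<in> lcarrier L" and B: "B \<subseteq> lcarrier L"
  shows "\<exists>c. \<exists>y\<in>lspan L B. x = ladd L (lscale L c b) y"
  using x
proof induction
  case zero
  show ?case
    by (intro exI[of _ 0] bexI[of _ "lzero L"])
      (simp_all add: scale_zero_left b add_zero zero_closed lspan.zero)
next
  case (base x)
  then show ?case
  proof
    assume "x = b"
    then show ?thesis
      by (intro exI[of _ 1] bexI[of _ "lzero L"])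
        (simp_all add: scale_one b add_zero_right lspan.zero)
  next
    assume "x \<in> B"
    with B have "x \<in> lcarrier L" by auto
    with \<open>x \<in> B\<close> show ?thesis
      by (intro exI[of _ 0] bexI[of _ x])
        (simp_all add: scale_zero_left b add_zero lspan.base)
  qed
next
  case (add x x')
  then obtain c y c' y' where *: "y \<in> lspan L B" "y' \<in> lspan L B"
    "x = ladd L (lscale L c b) y" "x' = ladd L (lscale L c' b) y'"
    by blast
  then show ?case
    by (intro exI[of _ "c + c'"] bexI[of _ "ladd L y y'"])
      (simp_all add: scale_add_left b lspan.add lspan_closed[OF _ B] add_assoc add_left_comm
        scale_closed add_closed)
next
  case (scale x a)
  then obtain c y where "y \<in> lspan L B" "x = ladd L (lscale L c b) y"
    by blast
  then show ?case
    by (intro exI[of _ "a * c"] bexI[of _ "lscale L a y"])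
      (simp_all add: scale_scale b scale_add_right scale_closed lspan.scale lspan_closed[OF _ B])
qed

end

lemma lspan_finite:
  assumes "x \<in> lspan L (P ` S)"
  shows "\<exists>W. finite W \<and> W \<subseteq> S \<and> x \<in> lspan L (P ` W)"
  using assms
proof induction
  case zero
  show ?case by (intro exI[of _ "{}"]) (simp add: lspan.zero)
next
  case (base b)
  then obtain w where "w \<in> S" "b = P w" by blast
  then show ?case by (intro exI[of _ "{w}"]) (simp add: lspan.base)
next
  case (add x y)
  then obtain V W where *: "finite V" "V \<subseteq> S" "x \<in> lspan L (P ` V)"
    "finite W" "W \<subseteq> S" "y \<in> lspan L (P ` W)"
    by blast
  then have "x \<in> lspan L (P ` (V \<union> W))" "y \<in> lspan L (P ` (V \<union> W))"
    by (auto elim!: lspan_mono[rotated])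
  with * show ?case
    by (intro exI[of _ "V \<union> W"]) (simp add: lspan.add)
next
  case (scale x a)
  then show ?case by (blast intro: lspan.scale)
qed

lemma commutator_cong:
  "(\<And>x. x \<in> letters w \<Longrightarrow> g x = h x) \<Longrightarrow> commutator L g w = commutator L h w"
  by (induction w) auto

text \<open>
  Applied to the indicator of the empty word, an element of the free associative algebra acting by
  left multiplication returns its own coefficients.
\<close>

abbreviation empty_word :: "'x list \<Rightarrow> 'a::{comm_ring,comm_monoid_mult}" where
  "empty_word \<equiv> \<lambda>p. if p = [] then 1 else 0"

lemma lyndon_element_empty_word:
  fixes v w :: "'x::linorder list"
  assumes "lyndon v" "w < v"
  shows "prepend_commutator (lyndon_tree v) empty_word w = (0 :: 'a::{comm_ring,comm_monoid_mult})"
proof (rule ccontr)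
  assume nz: "prepend_commutator (lyndon_tree v) empty_word w \<noteq> (0 :: 'a)"
  have "\<forall>x f q. prepend x f q \<noteq> (0 :: 'a) \<longrightarrow> (\<exists>r. q = x # r \<and> f r \<noteq> 0 \<and> True)"
    by (auto simp: prepend_def split: list.splits if_splits)
  from this nz obtain p r where
    "w = p @ r" "length p = bword_length (lyndon_tree v)" "(empty_word r :: 'a) \<noteq> 0"
    by (rule commutator_support[where Q = "\<lambda>_ _. True"])
  then have "length w = length v"
    using length_lyndon_tree[OF assms(1)] by (auto split: if_splits)
  with lyndon_leading_word(2)[OF assms(1), of w "empty_word :: 'x list \<Rightarrow> 'a" "[]"] assms(2) nz
  show False by simp
qed

text \<open>
  In a vanishing combination of Lyndon elements, the coefficient at the least Lyndon word involved
  receives no contribution from the others, so it is zero; all coefficients vanish by induction.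
  The test on the single vector \<open>empty_word\<close> suits the comparison with the quotient, where only
  functions pulled back along a substitution of words are available.
\<close>

lemma free_lie_faithful:
  fixes X :: "'x::linorder set" and z :: "('x bword \<Rightarrow> 'a::{comm_ring,comm_monoid_mult}) set"
  assumes fin: "finite X" and hom: "lhom (free_lie X) linear_maps \<theta>"
    and gen: "\<forall>x\<in>X. \<theta> (free_lie_gen X x) = prepend x"
    and z: "z \<in> lcarrier (free_lie X)" and kernel: "\<theta> z empty_word = (\<lambda>p. 0)"
  shows "z = lzero (free_lie X)"
proof -
  let ?F = "free_lie X :: ('a, _) lalg"
  let ?P = "lyndon_element ?F (free_lie_gen X)"
  interpret lie_algebra ?F
    by (rule lie_algebra_free_lie)
  interpret M: lie_algebra "linear_maps :: ('a, ('x list \<Rightarrow> 'a) \<Rightarrow> 'x list \<Rightarrow> 'a) lalg"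
    by (rule lie_algebra_linear_maps)
  have closed: "?P w \<in> lcarrier ?F" if "w \<in> lyndon_words X" for w
    using that by (intro lyndon_element_closed[of _ X]) (auto intro: free_lie_gen_closed)
  have image: "\<theta> (?P w) = prepend_commutator (lyndon_tree w)" if "w \<in> lyndon_words X" for w
  proof -
    have letters: "letters (lyndon_tree w) \<subseteq> X"
      using that by (simp add: lyndon_words_def letters_lyndon_tree)
    then have "\<theta> (?P w) = commutator linear_maps (\<lambda>x. \<theta> (free_lie_gen X x)) (lyndon_tree w)"
      by (intro lhom_commutator[OF hom]) (auto intro: free_lie_gen_closed)
    also have "\<dots> = prepend_commutator (lyndon_tree w)"
      using letters gen by (intro commutator_cong) auto
    finally show ?thesis .
  qed
  \<comment> \<open>Elements with Lyndon words beyond \<open>w\<close> have coefficient zero at \<open>w\<close>.\<close>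
  have later: "\<theta> y empty_word w = 0"
    if y: "y \<in> lspan ?F (?P ` W)" and W: "W \<subseteq> lyndon_words X" and less: "\<forall>v\<in>W. w < v" for y w W
  proof -
    have B: "?P ` W \<subseteq> lcarrier ?F"
      using W by (auto intro: closed)
    show ?thesis
      using y
    proof induction
      case zero
      then show ?case
        using lhom_zero[OF hom M.nonassoc_algebra_axioms] by (simp add: linear_maps_simps)
    next
      case (base b)
      then obtain v where v: "v \<in> W" "b = ?P v" by blast
      then have "lyndon v" "v \<in> lyndon_words X"
        using W by (auto simp: lyndon_words_def)
      with v less show ?case
        by (simp add: image lyndon_element_empty_word)
    qed (simp_all add: lhomD[OF hom] lspan_closed[OF _ B] linear_maps_simps)
  qed
  have independent: "y = lzero ?F"
    if "finite W" "W \<subseteq> lyndon_words X" "y \<in> lspan ?F (?P ` W)" "\<theta> y empty_word = (\<lambda>p. 0)" for W y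
    using that
  proof (induction W arbitrary: y rule: finite_linorder_min_induct)
    case empty
    then show ?case by (intro lspan_empty) simp
  next
    case (insert w W)
    have w: "w \<in> lyndon_words X" "lyndon w" and W: "W \<subseteq> lyndon_words X"
      using insert.prems by (auto simp: lyndon_words_def)
    have B: "?P ` W \<subseteq> lcarrier ?F"
      using W by (auto intro: closed)
    have "y \<in> lspan ?F (insert (?P w) (?P ` W))"
      using insert.prems(2) by simp
    from lspan_insert[OF this closed[OF w(1)] B] obtain c x
      where x: "x \<in> lspan ?F (?P ` W)" and y: "y = ladd ?F (lscale ?F c (?P w)) x"
      by blast
    note x_closed = lspan_closed[OF x B]
    have "\<theta> y empty_word w = c * prepend_commutator (lyndon_tree w) empty_word w + \<theta> x empty_word w"
      using w(1) x_closed
      by (simp add: y lhomD[OF hom] closed scale_closed linear_maps_simps image)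
    also have "prepend_commutator (lyndon_tree w) empty_word w = (1 :: 'a)"
      using lyndon_leading_word(1)[OF w(2), of empty_word "[]"] by simp
    also have "\<theta> x empty_word w = 0"
      using later[OF x W] insert.hyps by blast
    finally have "c = 0"
      using insert.prems(3) by simp
    then have "y = x"
      using w(1) x_closed by (simp add: y scale_zero_left closed add_zero)
    with insert.IH[OF W x] insert.prems(3) show ?case by simp
  qed
  obtain W where "finite W" "W \<subseteq> lyndon_words X" "z \<in> lspan ?F (?P ` W)"
    using lspan_finite[OF free_lie_spanned_by_lyndon_elements[OF fin z]] by blast
  then show ?thesis
    using kernel by (rule independent)
qed

section \<open>A representation of the algebra with repeated commutators killed\<close>

text \<open>
  Here \<open>q\<close> is the word after prepending, so its length is the position, counted from the right, of the
  new letter.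
  For \<open>i = n + 1\<close> the condition agrees with that for \<open>i = 1\<close>.
\<close>

definition staged :: "nat \<Rightarrow> nat \<Rightarrow> (nat list \<Rightarrow> 'a) \<Rightarrow> nat list \<Rightarrow> 'a::{comm_ring,comm_monoid_mult}" where
  "staged n i f q = (if i mod n = length q mod n then prepend i f q else 0)"

lemma staged_closed: "staged n i \<in> lcarrier linear_maps"
  by (rule linear_mapsI) (auto simp: staged_def prepend_def fun_eq_iff split: list.split)

lemma staged_support:
  "\<forall>i f q. staged n i f q \<noteq> 0 \<longrightarrow> (\<exists>r. q = i # r \<and> f r \<noteq> 0 \<and> i mod n = length q mod n)"
  by (auto simp: staged_def prepend_def split: list.splits if_splits)

lemma mod_eq_imp_eq:
  fixes a b n :: nat
  assumes "a mod n = b mod n" "a \<le> b" "b < a + n"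
  shows "a = b"
proof -
  have "n dvd b - a"
    using assms(1,2) by (metis mod_eq_dvd_iff_nat)
  moreover have "b - a < n"
    using assms by linarith
  ultimately show ?thesis
    using assms(2) by (auto dest: dvd_imp_le)
qed

text \<open>
  Letters at distance less than \<open>n\<close> in a word produced by these operators have different residues,
  so a commutator of length at most \<open>n\<close> can only produce words without repetition.
\<close>

lemma staged_repeated_commutator:
  assumes "bword_length w \<le> n" "card (letters w) < bword_length w"
  shows "commutator linear_maps (staged n) w = lzero linear_maps" (is "?C = _")
proof (rule ccontr)
  assume "?C \<noteq> lzero linear_maps"
  then have "\<exists>f q. ?C f q \<noteq> 0"
    by (auto simp: linear_maps_simps fun_eq_iff)
  then obtain f q where "?C f q \<noteq> 0"
    by blast
  from staged_support this obtain p r where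
    p: "q = p @ r" "length p = bword_length w" "set p = letters w"
      "\<forall>j<length p. p ! j mod n = (length q - j) mod n"
    by (rule commutator_support[where Q = "\<lambda>i k. i mod n = k mod n"])
  have neq: "p ! i \<noteq> p ! j" if "i < j" "j < length p" for i j
  proof
    assume eq: "p ! i = p ! j"
    have "p ! i mod n = (length q - i) mod n" "p ! j mod n = (length q - j) mod n"
      using p(4) less_trans[OF that] that(2) by blast+
    with eq have "(length q - j) mod n = (length q - i) mod n"
      by simp
    then have "length q - j = length q - i"
      by (rule mod_eq_imp_eq) (use that assms(1) p(1,2) in auto)
    with that p(1) show False by simp
  qed
  have "distinct p"
    unfolding distinct_conv_nth using neq by (metis linorder_neqE_nat)
  then have "card (letters w) = bword_length w"
    using p(2,3) distinct_card by metis
  with assms(2) show False by simp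
qed

text \<open>
  \<open>tower i m\<close> is \<open>[x\<^bsub>m+1\<^esub>, [\<dots>, [x\<^sub>3, [x\<^sub>2, x\<^sub>i]]]]\<close>, and \<open>tower_word i m\<close> is the
  sequence of its letters.
\<close>

fun tower :: "nat \<Rightarrow> nat \<Rightarrow> nat bword" where
  "tower i 0 = Letter i"
| "tower i (Suc m) = Bracket (Letter (m + 2)) (tower i m)"

fun tower_word :: "nat \<Rightarrow> nat \<Rightarrow> nat list" where
  "tower_word i 0 = [i]"
| "tower_word i (Suc m) = (m + 2) # tower_word i m"

lemma letters_tower: "letters (tower i m) = insert i {2..m + 1}"
proof (induction m)
  case (Suc m)
  have "{2..Suc m + 1} = insert (m + 2) {2..m + 1}" by auto
  with Suc show ?case by auto
qed simp

lemma length_tower_word: "length (tower_word i m) = Suc m"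
  by (induction m) auto

lemma tower_word_inject: "tower_word i m = tower_word j m \<longleftrightarrow> i = j"
  by (induction m) auto

text \<open>
  Of the two products in \<open>[x\<^bsub>m+2\<^esub>, tower i m]\<close> the second one vanishes at the lengths considered:
  its first letter would have to be congruent to \<open>m + 2\<close>, while the letters of \<open>tower i m\<close> are
  congruent to numbers between \<open>1\<close> and \<open>m + 1\<close>, and \<open>m + 2 \<le> n\<close>.
\<close>

lemma tower_action:
  assumes "m < n" "i mod n = 1 mod n" "length q mod n = Suc m mod n"
  shows "commutator linear_maps (staged n) (tower i m) f q =
    (if take (Suc m) q = tower_word i m then f (drop (Suc m) q) else 0)"
  using assms(1,3)
proof (induction m arbitrary: f q)
  case 0
  with assms(2) show ?case
    by (cases q) (auto simp: staged_def prepend_simps)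
next
  case (Suc m)
  let ?C = "commutator linear_maps (staged n) (tower i m)"
  have "?C (staged n (m + 2) f) q = 0"
  proof (rule ccontr)
    assume "?C (staged n (m + 2) f) q \<noteq> 0"
    from staged_support this obtain p r where
      p: "q = p @ r" "length p = bword_length (tower i m)" "set p = letters (tower i m)"
        "staged n (m + 2) f r \<noteq> 0" "\<forall>j<length p. p ! j mod n = (length q - j) mod n"
      by (rule commutator_support[where Q = "\<lambda>i k. i mod n = k mod n"])
    have "p \<noteq> []"
      using p(3) by (auto simp: letters_tower)
    then have mem: "p ! 0 \<in> insert i {2..m + 1}" and mod: "p ! 0 mod n = (m + 2) mod n"
      using nth_mem[of 0 p] p(3,5) Suc.prems(2) by (simp_all add: letters_tower)
    have "\<exists>k. 1 \<le> k \<and> k \<le> m + 1 \<and> k mod n = (m + 2) mod n"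
    proof (cases "p ! 0 = i")
      case True
      with mod assms(2) show ?thesis by (intro exI[of _ 1]) simp
    next
      case False
      with mem mod show ?thesis by (intro exI[of _ "p ! 0"]) simp
    qed
    then obtain k where "1 \<le> k" "k \<le> m + 1" "k mod n = (m + 2) mod n" by blast
    with Suc.prems(1) mod_eq_imp_eq[of k n "m + 2"] show False by simp
  qed
  moreover have "staged n (m + 2) (?C f) q =
    (if take (Suc (Suc m)) q = tower_word i (Suc m) then f (drop (Suc (Suc m)) q) else 0)"
  proof (cases q)
    case Nil
    then show ?thesis by (simp add: staged_def prepend_simps)
  next
    case (Cons y p)
    with Suc.prems(2) have "length p mod n = Suc m mod n"
      by (simp add: mod_Suc split: if_splits)
    with Suc.prems(1) have "?C f p = (if take (Suc m) p = tower_word i m then f (drop (Suc m) p) else 0)"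
      by (intro Suc.IH) simp_all
    with Suc.prems(2) Cons show ?thesis
      by (simp add: staged_def[of n "Suc (Suc m)"] prepend_simps)
  qed
  ultimately show ?case
    by (simp add: linear_maps_simps)
qed


text \<open>
  The letters \<open>1\<close> and \<open>2\<close> of the free Lie algebra correspond to the towers on \<open>x\<^sub>1\<close> and
  \<open>x\<^bsub>n+1\<^esub>\<close>. Other numbers, which also occur as letters of words of natural numbers, get the index
  \<open>0\<close>, which differs from both.
\<close>

definition tower_start :: "nat \<Rightarrow> nat \<Rightarrow> nat" where
  "tower_start n j = (if j = 1 then 1 else if j = 2 then n + 1 else 0)"

definition tower_expand :: "nat \<Rightarrow> nat list \<Rightarrow> nat list" where
  "tower_expand n p = concat (map (\<lambda>j. tower_word (tower_start n j) (n - 1)) p)"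

lemma length_tower_expand: "1 \<le> n \<Longrightarrow> length (tower_expand n p) = n * length p"
  by (induction p) (auto simp: tower_expand_def length_tower_word)

lemma tower_expand_eq_Nil: "1 \<le> n \<Longrightarrow> tower_expand n p = [] \<longleftrightarrow> p = []"
  using length_tower_expand[of n p] by auto

text \<open>
  Pulling functions back along \<open>tower_expand\<close> turns the action of the towers into the free action,
  because all blocks have length \<open>n\<close> and different letters have different blocks.
\<close>

lemma tower_acts_as_letter:
  assumes n: "1 \<le> n" and j: "j \<in> {1, 2}"
  shows "commutator linear_maps (staged n) (tower (tower_start n j) (n - 1)) f (tower_expand n p) =
    prepend j (\<lambda>p. f (tower_expand n p)) p"
proof -
  have "tower_start n j mod n = 1 mod n"
    using j mod_add_self1[of n 1] by (auto simp: tower_start_def simp del: mod_add_self1)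
  then have action: "commutator linear_maps (staged n) (tower (tower_start n j) (n - 1)) f
      (tower_expand n p) =
    (if take n (tower_expand n p) = tower_word (tower_start n j) (n - 1)
     then f (drop n (tower_expand n p)) else 0)"
    using n tower_action[of "n - 1" n "tower_start n j" "tower_expand n p" f]
    by (simp add: length_tower_expand)
  show ?thesis
  proof (cases p)
    case Nil
    then have "take n (tower_expand n p) \<noteq> tower_word (tower_start n j) (n - 1)"
      using length_tower_word[of "tower_start n j" "n - 1"] by (auto simp: tower_expand_def)
    with Nil show ?thesis
      unfolding action by (simp add: prepend_simps)
  next
    case (Cons k p')
    have "length (tower_word (tower_start n k) (n - 1)) = n"
      using n by (simp add: length_tower_word)
    moreover have "tower_expand n p = tower_word (tower_start n k) (n - 1) @ tower_expand n p'"
      by (simp add: Cons tower_expand_def)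
    ultimately have "take n (tower_expand n p) = tower_word (tower_start n k) (n - 1)"
      "drop n (tower_expand n p) = tower_expand n p'"
      by simp_all
    moreover have "tower_start n k = tower_start n j \<longleftrightarrow> k = j"
      using j n by (auto simp: tower_start_def split: if_splits)
    ultimately show ?thesis
      unfolding action by (auto simp: Cons prepend_simps tower_word_inject)
  qed
qed

theorem theorem1:
  fixes n :: nat
  assumes "n \<ge> 1"
  shows "\<exists>S. lsubalgebra S (rep_free_lie n :: ('a::{comm_ring,comm_monoid_mult}, _) lalg) \<and>
    lisomorphic (free_lie {1, 2 :: nat} :: ('a, _) lalg)
      ((rep_free_lie n :: ('a, _) lalg)\<lparr>lcarrier := S\<rparr>)"
proof -
  let ?X = "{1..n + 2}"
  let ?F = "free_lie {1..n + 2} :: ('a, _) lalg"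
  let ?R = "rep_free_lie n :: ('a, _) lalg"
  let ?E = "free_lie {1, 2} :: ('a, (nat bword \<Rightarrow> 'a) set) lalg"
  let ?M = "linear_maps :: ('a, (nat list \<Rightarrow> 'a) \<Rightarrow> nat list \<Rightarrow> 'a) lalg"
  let ?I = "generated_lideal ?F (repeated_commutators (n + 2) n)"
  interpret F: lie_algebra ?F by (rule lie_algebra_free_lie)
  interpret R: lie_algebra ?R by (rule lie_algebra_rep_free_lie)
  interpret E: lie_algebra ?E by (rule lie_algebra_free_lie)
  interpret M: lie_algebra ?M by (rule lie_algebra_linear_maps)
  obtain \<theta> where \<theta>: "lhom ?F ?M \<theta>" and \<theta>_gen: "\<forall>x\<in>?X. \<theta> (free_lie_gen ?X x) = staged n x"
    by (rule M.free_lie_universal[OF staged_closed])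
  have relators: "r \<in> lcarrier ?F \<and> \<theta> r = lzero ?M" if "r \<in> repeated_commutators (n + 2) n" for r
  proof -
    from that obtain w where r: "r = commutator ?F (free_lie_gen ?X) w" and w: "letters w \<subseteq> ?X"
      "bword_length w \<le> n" "card (letters w) < bword_length w"
      unfolding repeated_commutators_def by blast
    have gen: "free_lie_gen ?X x \<in> lcarrier ?F" if "x \<in> letters w" for x
      using that w(1) by (intro free_lie_gen_closed) auto
    have "\<theta> r = commutator ?M (\<lambda>x. \<theta> (free_lie_gen ?X x)) w"
      unfolding r by (rule F.lhom_commutator[OF \<theta> gen])
    also have "\<dots> = commutator ?M (staged n) w"
      using w(1) \<theta>_gen by (intro commutator_cong) auto
    also have "\<dots> = lzero ?M"
      using w(2,3) by (rule staged_repeated_commutator)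
    finally show ?thesis
      using F.commutator_closed[OF gen] by (simp add: r)
  qed
  then have sub: "repeated_commutators (n + 2) n \<subseteq> lcarrier ?F" by blast
  obtain \<psi> where \<psi>: "lhom ?R ?M \<psi>" and \<psi>_coset: "\<forall>x\<in>lcarrier ?F. \<psi> (lcoset ?F ?I x) = \<theta> x"
    unfolding rep_free_lie_def
    by (rule F.lhom_lquotient_generated[OF sub \<theta> M.nonassoc_algebra_axioms])
      (use relators in blast)
  define g where "g x = lcoset ?F ?I (free_lie_gen ?X x)" for x
  have g: "g x \<in> lcarrier ?R" "\<psi> (g x) = staged n x" if "x \<in> ?X" for x
  proof -
    have gen: "free_lie_gen ?X x \<in> lcarrier ?F"
      using that by (rule free_lie_gen_closed)
    then show "g x \<in> lcarrier ?R"
      unfolding g_def rep_free_lie_def F.lquotient_carrier_zero(1) by (rule imageI)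
    show "\<psi> (g x) = staged n x"
      unfolding g_def using bspec[OF \<psi>_coset gen] bspec[OF \<theta>_gen that] by (rule trans)
  qed
  define t where "t j = tower (tower_start n j) (n - 1)" for j
  have t: "letters (t j) \<subseteq> ?X" if "j \<in> {1, 2}" for j
    using that assms by (auto simp: t_def letters_tower tower_start_def)
  have t_closed: "commutator ?R g (t j) \<in> lcarrier ?R" if "j \<in> {1, 2}" for j
    using t[OF that] by (intro R.commutator_closed g) auto
  obtain \<phi> where \<phi>: "lhom ?E ?R \<phi>"
    and \<phi>_gen: "\<forall>j\<in>{1, 2}. \<phi> (free_lie_gen {1, 2} j) = commutator ?R g (t j)"
    by (rule R.free_lie_universal[OF t_closed])
  obtain \<eta> where \<eta>: "lhom ?E ?M \<eta>"
    and \<eta>_gen: "\<forall>j\<in>{1, 2}. \<eta> (free_lie_gen {1, 2} j) = prepend j"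
    by (rule M.free_lie_universal[OF prepend_closed])
  have \<psi>_tower: "\<psi> (commutator ?R g (t j)) = commutator ?M (staged n) (t j)" if "j \<in> {1, 2}" for j
  proof -
    have "\<psi> (commutator ?R g (t j)) = commutator ?M (\<lambda>x. \<psi> (g x)) (t j)"
      using t[OF that] by (intro R.lhom_commutator[OF \<psi>] g) auto
    also have "\<dots> = commutator ?M (staged n) (t j)"
      using t[OF that] by (intro commutator_cong g) auto
    finally show ?thesis .
  qed
  \<comment> \<open>Restricted to expanded words, the composite representation is the free one.\<close>
  have intertwine: "\<forall>f. (\<lambda>p. \<psi> (\<phi> z) f (tower_expand n p)) = \<eta> z (\<lambda>p. f (tower_expand n p))"
    if "z \<in> lcarrier ?E" for z
    using that
  proof (induction rule: free_lie_induct)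
    case zero
    show ?case
      using E.lhom_zero[OF \<phi> R.nonassoc_algebra_axioms] R.lhom_zero[OF \<psi> M.nonassoc_algebra_axioms]
        E.lhom_zero[OF \<eta> M.nonassoc_algebra_axioms]
      by (simp add: linear_maps_simps)
  next
    case (gen j)
    have "\<psi> (\<phi> (free_lie_gen {1, 2} j)) = commutator ?M (staged n) (t j)"
      using bspec[OF \<phi>_gen gen] \<psi>_tower[OF gen] by (rule ssubst)
    then show ?case
      unfolding bspec[OF \<eta>_gen gen] t_def by (simp only: tower_acts_as_letter[OF assms gen]) simp
  next
    case (bracket y z)
    then show ?case
      by (simp add: lhomD[OF \<phi>] lhomD[OF \<psi>] lhomD[OF \<eta>] linear_maps_simps fun_eq_iff del: One_nat_def)
  qed (simp_all add: lhomD[OF \<phi>] lhomD[OF \<psi>] lhomD[OF \<eta>] linear_maps_simps fun_eq_iff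
      del: One_nat_def)
  have "inj_on \<phi> (lcarrier ?E)"
  proof (rule E.lhom_inj_onI[OF \<phi> R.nonassoc_algebra_axioms])
    fix z assume z: "z \<in> lcarrier ?E" and "\<phi> z = lzero ?R"
    then have "\<psi> (\<phi> z) = lzero ?M"
      using R.lhom_zero[OF \<psi> M.nonassoc_algebra_axioms] by simp
    then have "\<eta> z (\<lambda>p. empty_word (tower_expand n p)) = (\<lambda>p. 0)"
      using intertwine[OF z, rule_format, of empty_word] by (simp add: linear_maps_simps)
    then have "\<eta> z empty_word = (\<lambda>p. 0)"
      using assms by (simp add: tower_expand_eq_Nil)
    with z show "z = lzero ?E"
      by (intro free_lie_faithful[OF _ \<eta> \<eta>_gen]) simp_all
  qed
  from E.lisomorphic_image[OF \<phi> this R.nonassoc_algebra_axioms] show ?thesis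
    by blast
qed

end
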